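(* Let $\mathsf X$ be the $d$-dimensional hyperbolic space $\mathbb H^d$ and let $\mathbf P$ be a probability measure on $\mathsf M(\mathsf X)$, with expectation $\mathbf E$. If $\mathbf E\big[\omega(\mathsf B(0,2))^d\big]<\infty$, then the expected (under $\mathbf P$) number of connected components of $\mathcal V(\omega)\cap\mathsf B(0,1)$ is finite.
   Context: $0$ is a marked origin of $\mathbb H^d$ and $\mathsf B(x,r)$ denotes the closed hyperbolic ball of radius $r$ around $x$. $\mathsf M(\mathsf X)$ is the set of simple counting measures $\omega=\sum_i\delta_{x_i}$ on $\mathsf X$ (distinct $x_i\in\mathsf X$, $\omega(B)<\infty$ for all bounded Borel $B$), with the $\sigma$-algebra generated by the maps $\omega\mapsto\omega(B)$, $B$ Borel. The occupied set is $\mathcal O(\omega)=\bigcup_{x\in\mathrm{supp}(\omega)}\mathsf B(x,1)$ and the vacant set is $\mathcal V(\omega)=\mathsf X\setminus\mathcal O(\omega)$. *)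

theory Defs
  imports "HOL-Probability.Probability"
begin

section \<open>Hyperbolic space\<close>

definition lorentz :: "(real^'d) \<times> real \<Rightarrow> (real^'d) \<times> real \<Rightarrow> real" where
  "lorentz p q = snd p * snd q - fst p \<bullet> fst q"

text \<open>
  The hyperboloid model of hyperbolic space of dimension \<^term>\<open>CARD('d)\<close>:
  the upper sheet of the unit hyperboloid in Minkowski space, whose geodesic distance
  (curvature \<open>-1\<close>) is the \<^const>\<open>arcosh\<close> of the Lorentz product.
\<close>

typedef (overloaded) ('d::finite) hyp =
    "{p :: (real^'d) \<times> real. 0 < snd p \<and> lorentz p p = 1}"
  by (rule exI[of _ "(0, 1)"]) (simp add: lorentz_def)

lemma lorentz_commute: "lorentz p q = lorentz q p"
  by (simp add: lorentz_def inner_commute)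

lemma lorentz_add_left: "lorentz (p + p') q = lorentz p q + lorentz p' q"
  by (simp add: lorentz_def algebra_simps)

lemma lorentz_diff_left: "lorentz (p - p') q = lorentz p q - lorentz p' q"
  by (simp add: lorentz_def algebra_simps)

lemma lorentz_scaleR_left: "lorentz (c *\<^sub>R p) q = c * lorentz p q"
  by (simp add: lorentz_def algebra_simps)

lemma lorentz_add_right: "lorentz q (p + p') = lorentz q p + lorentz q p'"
  by (simp add: lorentz_def algebra_simps)

lemma lorentz_diff_right: "lorentz q (p - p') = lorentz q p - lorentz q p'"
  by (simp add: lorentz_def algebra_simps)

lemma lorentz_scaleR_right: "lorentz q (c *\<^sub>R p) = c * lorentz q p"
  by (simp add: lorentz_def algebra_simps)

lemmas lorentz_bilinear =
  lorentz_add_left lorentz_diff_left lorentz_scaleR_left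
  lorentz_add_right lorentz_diff_right lorentz_scaleR_right

lemma lorentz_orthogonal:
  assumes y: "lorentz y y = 1" and u: "lorentz u y = 0"
  shows "lorentz u u \<le> 0" and "lorentz u u = 0 \<Longrightarrow> u = 0"
proof -
  define n where "n = fst y \<bullet> fst y"
  define m where "m = fst u \<bullet> fst u"
  have n: "(snd y)\<^sup>2 = 1 + n" "0 \<le> n"
    using y by (auto simp: lorentz_def n_def power2_eq_square)
  have m: "0 \<le> m" by (simp add: m_def)
  have uy: "snd u * snd y = fst u \<bullet> fst y"
    using u by (simp add: lorentz_def)
  have "(snd u * snd y)\<^sup>2 \<le> m * n"
    unfolding uy m_def n_def by (rule Cauchy_Schwarz_ineq)
  then have *: "(snd u)\<^sup>2 * (1 + n) \<le> m * n"
    by (simp add: power_mult_distrib n)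
  have key: "(snd u)\<^sup>2 \<le> 0" if "m \<le> (snd u)\<^sup>2"
  proof -
    have "m * n \<le> (snd u)\<^sup>2 * n"
      using that n(2) by (rule mult_right_mono)
    with * show ?thesis unfolding distrib_left by linarith
  qed
  have eq: "lorentz u u = (snd u)\<^sup>2 - m"
    by (simp add: lorentz_def m_def power2_eq_square)
  show "lorentz u u \<le> 0"
    using key m unfolding eq by linarith
  show "u = 0" if "lorentz u u = 0"
  proof -
    have e: "(snd u)\<^sup>2 = m" using that unfolding eq by simp
    with key have "m \<le> 0" by simp
    with m have "m = 0" by simp
    with e have "snd u = 0" "fst u = 0" by (auto simp: m_def)
    then show ?thesis by (simp add: prod_eq_iff)
  qed
qed

lemma lorentz_Cauchy_Schwarz:
  assumes y: "lorentz y y = 1" and u: "lorentz u y = 0" and w: "lorentz w y = 0"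
  shows "(lorentz u w)\<^sup>2 \<le> lorentz u u * lorentz w w"
proof (cases "lorentz w w = 0")
  case True
  then have "w = 0" using lorentz_orthogonal[OF y w] by blast
  then show ?thesis by (simp add: lorentz_def)
next
  case False
  then have neg: "lorentz w w < 0" using lorentz_orthogonal(1)[OF y w] by simp
  define r where "r = lorentz u w / lorentz w w"
  have "lorentz (u - r *\<^sub>R w) y = 0" using u w by (simp add: lorentz_bilinear)
  then have "lorentz (u - r *\<^sub>R w) (u - r *\<^sub>R w) \<le> 0"
    by (rule lorentz_orthogonal(1)[OF y])
  moreover have "lorentz (u - r *\<^sub>R w) (u - r *\<^sub>R w)
      = lorentz u u - 2 * r * lorentz u w + r * (r * lorentz w w)"
    by (simp add: lorentz_bilinear lorentz_commute[of w u] algebra_simps)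
  moreover have "r * lorentz w w = lorentz u w" using False by (simp add: r_def)
  ultimately have "lorentz u u - r * lorentz u w \<le> 0" by simp
  then have "(lorentz u u - r * lorentz u w) * lorentz w w \<ge> 0"
    using neg by (simp add: mult_nonpos_nonpos)
  then have "lorentz u u * lorentz w w - (r * lorentz w w) * lorentz u w \<ge> 0"
    by (simp add: algebra_simps)
  then show ?thesis
    using \<open>r * lorentz w w = lorentz u w\<close> by (simp add: power2_eq_square)
qed

lemma lorentz_hyp_self: "lorentz (Rep_hyp x) (Rep_hyp x) = 1"
  using Rep_hyp[of x] by simp

lemma lorentz_hyp_ge_1: "1 \<le> lorentz (Rep_hyp x) (Rep_hyp y)"
proof -
  define a where "a = lorentz (Rep_hyp x) (Rep_hyp y)"
  obtain p s where X: "Rep_hyp x = (p, s)" by fastforce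
  obtain q t where Y: "Rep_hyp y = (q, t)" by fastforce
  have s: "0 < s" "s * s = 1 + p \<bullet> p" using Rep_hyp[of x] X by (auto simp: lorentz_def)
  have t: "0 < t" "t * t = 1 + q \<bullet> q" using Rep_hyp[of y] Y by (auto simp: lorentz_def)
  have "norm p < s"
  proof (rule power_less_imp_less_base)
    show "(norm p)\<^sup>2 < s\<^sup>2"
      unfolding power2_norm_eq_inner using s(2) by (simp add: power2_eq_square)
  qed (use s(1) in simp)
  moreover have "norm q < t"
  proof (rule power_less_imp_less_base)
    show "(norm q)\<^sup>2 < t\<^sup>2"
      unfolding power2_norm_eq_inner using t(2) by (simp add: power2_eq_square)
  qed (use t(1) in simp)
  ultimately have "norm p * norm q < s * t"
    by (intro mult_strict_mono') auto
  then have pos: "0 < a"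
    using norm_cauchy_schwarz[of p q] by (simp add: a_def X Y lorentz_def)
  have "lorentz (Rep_hyp x - a *\<^sub>R Rep_hyp y) (Rep_hyp y) = 0"
    by (simp add: lorentz_bilinear lorentz_hyp_self a_def)
  then have "lorentz (Rep_hyp x - a *\<^sub>R Rep_hyp y) (Rep_hyp x - a *\<^sub>R Rep_hyp y) \<le> 0"
    by (rule lorentz_orthogonal(1)[OF lorentz_hyp_self])
  then have "1 - a * a \<le> 0"
    by (simp add: lorentz_bilinear lorentz_hyp_self lorentz_commute[of "Rep_hyp y"] flip: a_def)
  then have "1\<^sup>2 \<le> a\<^sup>2" by (simp add: power2_eq_square)
  then show ?thesis
    using pos unfolding a_def by (auto intro: power2_le_imp_le)
qed

instantiation hyp :: (finite) metric_space
begin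

definition dist_hyp :: "'a hyp \<Rightarrow> 'a hyp \<Rightarrow> real" where
  "dist_hyp x y = arcosh (lorentz (Rep_hyp x) (Rep_hyp y))"

definition uniformity_hyp :: "('a hyp \<times> 'a hyp) filter" where
  "uniformity_hyp = (INF e\<in>{0 <..}. principal {(x, y). dist x y < e})"

definition open_hyp :: "'a hyp set \<Rightarrow> bool" where
  "open_hyp U = (\<forall>x\<in>U. eventually (\<lambda>(x', y). x' = x \<longrightarrow> y \<in> U) uniformity)"

instance
proof
  fix x y :: "'a hyp"
  define a where "a = lorentz (Rep_hyp x) (Rep_hyp y)"
  show "dist x y = 0 \<longleftrightarrow> x = y"
  proof
    assume "dist x y = 0"
    then have a1: "a = 1"
      using lorentz_hyp_ge_1[of x y] by (simp add: dist_hyp_def a_def)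
    have "lorentz (Rep_hyp x - Rep_hyp y) (Rep_hyp y) = 0"
      using a1 by (simp add: lorentz_bilinear lorentz_hyp_self a_def)
    moreover have "lorentz (Rep_hyp x - Rep_hyp y) (Rep_hyp x - Rep_hyp y) = 0"
      using a1 by (simp add: lorentz_bilinear lorentz_hyp_self lorentz_commute[of "Rep_hyp y"] a_def)
    ultimately have "Rep_hyp x - Rep_hyp y = 0"
      by (rule lorentz_orthogonal(2)[OF lorentz_hyp_self])
    then show "x = y" by (simp add: Rep_hyp_inject)
  next
    assume "x = y"
    then show "dist x y = 0" by (simp add: dist_hyp_def lorentz_hyp_self)
  qed
next
  fix x z y :: "'a hyp"
  define a where "a = lorentz (Rep_hyp x) (Rep_hyp y)"
  define b where "b = lorentz (Rep_hyp z) (Rep_hyp y)"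
  define c where "c = lorentz (Rep_hyp x) (Rep_hyp z)"
  have ge: "1 \<le> a" "1 \<le> b" "1 \<le> c"
    by (simp_all add: a_def b_def c_def lorentz_hyp_ge_1)
  define u where "u = Rep_hyp x - a *\<^sub>R Rep_hyp y"
  define w where "w = Rep_hyp z - b *\<^sub>R Rep_hyp y"
  have "lorentz u (Rep_hyp y) = 0" "lorentz w (Rep_hyp y) = 0"
    by (simp_all add: u_def w_def lorentz_bilinear lorentz_hyp_self a_def b_def)
  then have "(lorentz u w)\<^sup>2 \<le> lorentz u u * lorentz w w"
    by (rule lorentz_Cauchy_Schwarz[OF lorentz_hyp_self])
  moreover have "lorentz u w = c - a * b"
    by (simp add: u_def w_def lorentz_bilinear lorentz_hyp_self a_def b_def c_def
        lorentz_commute[of "Rep_hyp y"] algebra_simps)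
  moreover have "lorentz u u = 1 - a\<^sup>2"
    by (simp add: u_def lorentz_bilinear lorentz_hyp_self a_def
        lorentz_commute[of "Rep_hyp y"] power2_eq_square)
  moreover have "lorentz w w = 1 - b\<^sup>2"
    by (simp add: w_def lorentz_bilinear lorentz_hyp_self b_def
        lorentz_commute[of "Rep_hyp y"] power2_eq_square)
  ultimately have "(c - a * b)\<^sup>2 \<le> (a\<^sup>2 - 1) * (b\<^sup>2 - 1)"
    by (simp add: algebra_simps)
  then have "c - a * b \<le> sqrt ((a\<^sup>2 - 1) * (b\<^sup>2 - 1))"
    by (rule real_le_rsqrt)
  then have "c \<le> cosh (arcosh a + arcosh b)"
    using ge by (simp add: cosh_add sinh_arcosh_real real_sqrt_mult)
  then have "arcosh c \<le> arcosh (cosh (arcosh a + arcosh b))"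
    using ge by (metis arcosh_real_strict_mono less_eq_real_def order_le_less)
  also have "\<dots> = arcosh a + arcosh b"
    using ge by (intro arcosh_cosh_real add_nonneg_nonneg) auto
  finally show "dist x z \<le> dist x y + dist z y"
    by (simp add: dist_hyp_def a_def b_def c_def)
next
  show "uniformity = (INF e\<in>{0 <..}. principal {(x, y :: 'a hyp). dist x y < e})"
    by (rule uniformity_hyp_def)
next
  fix U :: "'a hyp set"
  show "open U \<longleftrightarrow> (\<forall>x\<in>U. \<forall>\<^sub>F (x', y) in uniformity. x' = x \<longrightarrow> y \<in> U)"
    by (rule open_hyp_def)
qed

end

definition origin :: "'d::finite hyp" where
  "origin = Abs_hyp (0, 1)"


section \<open>Simple counting measures\<close>

text \<open>The Borel measure \<open>\<Sum>x\<in>S. \<delta>\<^sub>x\<close>, for a set \<open>S\<close> of (distinct) points.\<close>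

definition counting_measure :: "'d::finite hyp set \<Rightarrow> 'd hyp measure" where
  "counting_measure S = distr (count_space S) borel (\<lambda>x. x)"

lemma emeasure_counting_measure:
  assumes "B \<in> sets borel"
  shows "emeasure (counting_measure S) B = (\<integral>\<^sup>+x. emeasure (return borel x) B \<partial>count_space S)"
    and "emeasure (counting_measure S) B = emeasure (count_space UNIV) (S \<inter> B)"
proof -
  have eq: "emeasure (counting_measure S) B = emeasure (count_space S) (B \<inter> S)"
    unfolding counting_measure_def using assms by (subst emeasure_distr) auto
  have "(\<integral>\<^sup>+x. emeasure (return borel x) B \<partial>count_space S)
      = (\<integral>\<^sup>+x. indicator (B \<inter> S) x \<partial>count_space S)"
    using assms by (intro nn_integral_cong) (auto simp: indicator_def)
  also have "\<dots> = emeasure (count_space S) (B \<inter> S)"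
    by (intro nn_integral_indicator) auto
  finally show "emeasure (counting_measure S) B
      = (\<integral>\<^sup>+x. emeasure (return borel x) B \<partial>count_space S)"
    using eq by simp
  show "emeasure (counting_measure S) B = emeasure (count_space UNIV) (S \<inter> B)"
    unfolding eq by (simp add: emeasure_count_space Int_commute)
qed

definition simple_counting_measures :: "'d::finite hyp measure set" where
  "simple_counting_measures =
     {\<omega>. (\<exists>S. \<omega> = counting_measure S) \<and> (\<forall>B\<in>sets borel. bounded B \<longrightarrow> emeasure \<omega> B < \<infinity>)}"

text \<open>The measurable space of simple counting measures (its measure as such is irrelevant).\<close>

definition configurations :: "'d::finite hyp measure measure" where
  "configurations = sigma simple_counting_measures
     {{\<omega> \<in> simple_counting_measures. emeasure \<omega> B \<in> A} | B A. B \<in> sets borel \<and> A \<in> sets borel}"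

definition supp :: "'d::finite hyp measure \<Rightarrow> 'd hyp set" where
  "supp \<omega> = {x. \<forall>U. open U \<and> x \<in> U \<longrightarrow> emeasure \<omega> U > 0}"

definition occupied :: "'d::finite hyp measure \<Rightarrow> 'd hyp set" where
  "occupied \<omega> = (\<Union>x\<in>supp \<omega>. cball x 1)"

definition vacant :: "'d::finite hyp measure \<Rightarrow> 'd hyp set" where
  "vacant \<omega> = - occupied \<omega>"

text \<open>The number of connected components of a set, as a value in \<open>{0, 1, \<dots>, \<infinity>}\<close>.\<close>

definition num_components :: "'a::topological_space set \<Rightarrow> ennreal" where
  "num_components S = emeasure (count_space UNIV) (components S)"

end

(* Under the radial projection (p, s) |-> (p / s, 1 / s) the hyperboloid becomes an open hemisphere of
   the unit sphere of dimension d, and the complement of a ball becomes its intersection with an open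
   affine half-space. So the vacant set in the unit ball corresponds to a sphere intersected with
   n + 1 half-spaces, where n is the number of points in B(0,2). Adding a half-space with bounding
   hyperplane h to such a set W creates at most as many new components as W Int h has components, and
   W Int h is an intersection of the same kind on a sphere of one dimension less; by induction there
   are at most 2 (n + 2)^d components.
   For measurability, cover the vacant set by the members of a countable family of balls that it
   contains with some margin: the components are the chain-connected classes of these balls. *)
theory Submission
  imports Defs
begin

section \<open>Counting components\<close>

text \<open>The obstacle is tangency. Bounding the new components by those of the slice needs, near
  each slice point, a connected piece of the half-space side that has the slice in its closure; at a
  point where the hyperplane touches the sphere this side can be empty or, on a circle,
  disconnected. Testing with finite separated sets avoids this: finitely many points satisfy the
  strict inequality with room to spare, so the level of the hyperplane can be raised slightly to one
  where no slice consists of a single point. At such a level each slice point has a companion N in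
  the slice, and inversion at N flattens the sphere and keeps the hyperplane, so the half-space side
  becomes locally half of a ball. It follows that every slice component adheres to one component of
  the cut set. Components of the cut set that adhere to no slice point were already components
  before the cut.\<close>

text \<open>At most \<open>n\<close> components, stated via finite sets of pairwise separated points so that it
  can be tested against slightly shrunk sets.\<close>

definition comps_le :: "'a::topological_space set \<Rightarrow> nat \<Rightarrow> bool" where
  "comps_le S n \<longleftrightarrow>
     (\<forall>X. finite X \<and> X \<subseteq> S \<and> pairwise (\<lambda>x y. \<not> connected_component S x y) X \<longrightarrow> card X \<le> n)"

lemma comps_leD:
  "\<lbrakk>comps_le S n; finite X; X \<subseteq> S; pairwise (\<lambda>x y. \<not> connected_component S x y) X\<rbrakk>
    \<Longrightarrow> card X \<le> n"
  unfolding comps_le_def by blast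

lemma comps_le_mono: "comps_le S m \<Longrightarrow> m \<le> n \<Longrightarrow> comps_le S n"
  unfolding comps_le_def using le_trans by blast

lemma connected_component_image:
  assumes "continuous_on T f" "f ` T \<subseteq> S" "connected_component T x y"
  shows "connected_component S (f x) (f y)"
proof -
  obtain C where C: "connected C" "C \<subseteq> T" "x \<in> C" "y \<in> C"
    using assms(3) unfolding connected_component_def by blast
  then have "connected (f ` C)"
    using assms(1) connected_continuous_image continuous_on_subset by blast
  moreover have "f ` C \<subseteq> S" using C assms(2) by blast
  ultimately show ?thesis
    using C unfolding connected_component_def by blast
qed

text \<open>The map only has to reach every component of \<open>S\<close>. Choosing for each point
  of a separated set a point of \<open>T\<close> mapped into its component gives a separated set of
  the same size, because \<open>f\<close> would push a connection in \<open>T\<close> forward to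
  \<open>S\<close>.\<close>

lemma comps_le_image:
  assumes f: "continuous_on T f" "f ` T \<subseteq> S"
    and ex: "\<And>x. x \<in> S \<Longrightarrow> \<exists>y\<in>T. connected_component S x (f y)"
    and le: "comps_le T n"
  shows "comps_le S n"
  unfolding comps_le_def
proof (intro allI impI)
  fix X
  assume X: "finite X \<and> X \<subseteq> S \<and> pairwise (\<lambda>x y. \<not> connected_component S x y) X"
  obtain g where g: "\<And>x. x \<in> S \<Longrightarrow> g x \<in> T \<and> connected_component S x (f (g x))"
    using ex by metis
  have sep: "x = x'" if "x \<in> X" "x' \<in> X" "connected_component T (g x) (g x')" for x x'
  proof -
    have "connected_component S (f (g x)) (f (g x'))"
      using connected_component_image[OF f that(3)] .
    then have "connected_component S x x'"
      using g[of x] g[of x'] that X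
      by (meson connected_component_sym connected_component_trans subset_iff)
    then show ?thesis using X that by (auto simp: pairwise_def)
  qed
  have inj: "inj_on g X"
  proof (rule inj_onI)
    fix x x' assume "x \<in> X" "x' \<in> X" "g x = g x'"
    then show "x = x'" using sep g X by (metis connected_component_refl subset_iff)
  qed
  have "card (g ` X) \<le> n"
  proof (rule comps_leD[OF le])
    show "pairwise (\<lambda>x y. \<not> connected_component T x y) (g ` X)"
      using sep by (auto simp: pairwise_def)
  qed (use X g in auto)
  then show "card X \<le> n" by (simp add: card_image[OF inj])
qed

lemma num_components_le:
  assumes "comps_le S n"
  shows "num_components S \<le> of_nat n"
proof -
  have *: "card K \<le> n" if K: "finite K" "K \<subseteq> components S" for K
  proof -
    define g where "g C = (SOME x. x \<in> C)" for C :: "'a set"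
    have g: "g C \<in> C" if "C \<in> components S" for C
      unfolding g_def using in_components_nonempty[OF that] by (simp add: some_in_eq)
    have comp: "C = connected_component_set S (g C)" "g C \<in> S" if "C \<in> components S" for C
    proof -
      obtain x where x: "x \<in> S" "C = connected_component_set S x"
        using \<open>C \<in> components S\<close> by (auto simp: components_iff)
      then show "C = connected_component_set S (g C)"
        using connected_component_eq[of "g C" S x] g[OF that] by simp
      show "g C \<in> S" using g[OF that] in_components_subset[OF that] by blast
    qed
    have eq: "C = C'" if "C \<in> K" "C' \<in> K" "connected_component S (g C) (g C')" for C C'
      proof -
      have "connected_component_set S (g C') = connected_component_set S (g C)"
        using that(3) by (intro connected_component_eq) simp
      then show ?thesis using comp(1)[of C] comp(1)[of C'] K that(1,2) by blast
    qed
    have inj: "inj_on g K"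
    proof (rule inj_onI)
      fix C C' assume C: "C \<in> K" "C' \<in> K" "g C = g C'"
      then show "C = C'" using comp(1)[of C] comp(1)[of C'] K by (metis subset_iff)
    qed
    have "card (g ` K) \<le> n"
    proof (rule comps_leD[OF assms])
      show "g ` K \<subseteq> S" using comp(2) K by blast
      show "pairwise (\<lambda>x y. \<not> connected_component S x y) (g ` K)"
        using eq by (auto simp: pairwise_def)
    qed (use K in auto)
    then show ?thesis by (simp add: card_image[OF inj])
  qed
  have fin: "finite (components S)"
  proof (rule ccontr)
    assume "infinite (components S)"
    then obtain K where "finite K" "card K = Suc n" "K \<subseteq> components S"
      by (meson infinite_arbitrarily_large)
    with * show False by fastforce
  qed
  then show ?thesis
    unfolding num_components_def using *[OF fin] by simp
qed

section \<open>Spheres cut by half-spaces\<close>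

definition inversion :: "'a::real_inner \<Rightarrow> 'a \<Rightarrow> 'a" where
  "inversion N z = N + (1 / (norm (z - N))\<^sup>2) *\<^sub>R (z - N)"

lemma inversion_diff: "inversion N z - N = (1 / (norm (z - N))\<^sup>2) *\<^sub>R (z - N)"
  by (simp add: inversion_def)

lemma inversion_neq: "z \<noteq> N \<Longrightarrow> inversion N z \<noteq> N"
  by (simp add: inversion_def)

text \<open>As an involution, one map serves both as stereographic projection and as its
  inverse.\<close>

lemma inversion_inversion: "z \<noteq> N \<Longrightarrow> inversion N (inversion N z) = z"
  unfolding inversion_def[of N "inversion N z"] unfolding inversion_diff
  by (simp add: power_divide power2_eq_square)

lemma continuous_on_inversion: "N \<notin> T \<Longrightarrow> continuous_on T (inversion N)"
  unfolding inversion_def by (intro continuous_intros) auto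

text \<open>The vector \<open>z - N\<close> is only rescaled by a positive factor, so a hyperplane
  through \<open>N\<close> and both its sides are preserved. This is why the centre is later taken
  on the cutting hyperplane.\<close>

lemma inversion_halfspace:
  "z \<noteq> N \<Longrightarrow> u \<bullet> inversion N z > u \<bullet> N \<longleftrightarrow> u \<bullet> z > u \<bullet> N"
  "z \<noteq> N \<Longrightarrow> u \<bullet> inversion N z = u \<bullet> N \<longleftrightarrow> u \<bullet> z = u \<bullet> N"
  unfolding inversion_def
  by (auto simp: inner_add_right inner_diff_right zero_less_mult_iff zero_less_divide_iff)

text \<open>The image of \<open>A \<inter> sphere 0 1 - {N}\<close> under inversion at its point \<open>N\<close>.\<close>

definition polar_plane :: "'a::real_inner set \<Rightarrow> 'a \<Rightarrow> 'a set" where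
  "polar_plane A N = A \<inter> {w. N \<bullet> w = 1 / 2}"

lemma convex_polar_plane: "affine A \<Longrightarrow> convex (polar_plane A N)"
  unfolding polar_plane_def by (intro affine_imp_convex convex_Int convex_hyperplane)

lemma polar_plane_neq: "N \<in> sphere 0 1 \<Longrightarrow> N \<notin> polar_plane A N"
  by (simp add: polar_plane_def norm_eq_1)

lemma inversion_in_affine:
  assumes "affine A" "N \<in> A" "z \<in> A" shows "inversion N z \<in> A"
proof -
  have "inversion N z = (1 - 1 / (norm (z - N))\<^sup>2) *\<^sub>R N + (1 / (norm (z - N))\<^sup>2) *\<^sub>R z"
    by (simp add: inversion_def algebra_simps)
  then show ?thesis using assms by (simp add: affine_def)
qed

text \<open>With \<open>v = z - N\<close> the sphere is
  \<open>v \<bullet> v + 2 * (N \<bullet> v) = 0\<close>; dividing by \<open>v \<bullet> v\<close>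
  makes the equation linear in the inverted point. A sphere through the centre of inversion becomes
  a hyperplane.\<close>

lemma inversion_sphere_iff:
  assumes "N \<in> sphere 0 1" "z \<noteq> N"
  shows "z \<in> sphere 0 1 \<longleftrightarrow> N \<bullet> inversion N z = 1 / 2"
proof -
  define v where "v = z - N"
  have v: "v \<bullet> v \<noteq> 0" "z = N + v" using assms by (auto simp: v_def)
  have N: "N \<bullet> N = 1" using assms by (simp add: norm_eq_1)
  have "z \<in> sphere 0 1 \<longleftrightarrow> v \<bullet> v + 2 * (N \<bullet> v) = 0"
    by (simp add: norm_eq_1 v(2) inner_add_left inner_add_right N inner_commute) linarith
  also have "\<dots> \<longleftrightarrow> N \<bullet> inversion N z = 1 / 2"
    using v(1) unfolding inversion_def v_def[symmetric]
    by (simp add: inner_add_right N power2_norm_eq_inner field_simps)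
  finally show ?thesis .
qed

lemma inversion_in_polar_plane:
  "\<lbrakk>affine A; N \<in> A \<inter> sphere 0 1; z \<in> A \<inter> sphere 0 1; z \<noteq> N\<rbrakk> \<Longrightarrow> inversion N z \<in> polar_plane A N"
  using inversion_in_affine[of A N z] inversion_sphere_iff[of N z] by (simp add: polar_plane_def)

lemma inversion_polar_plane_sphere:
  assumes "affine A" "N \<in> A \<inter> sphere 0 1" "w \<in> polar_plane A N"
  shows "inversion N w \<in> A \<inter> sphere 0 1" "inversion N w \<noteq> N"
proof -
  have ne: "w \<noteq> N" using assms polar_plane_neq by blast
  then show "inversion N w \<noteq> N" by (rule inversion_neq)
  then have "inversion N w \<in> sphere 0 1"
    using assms ne inversion_sphere_iff[of N "inversion N w"]
    by (simp add: inversion_inversion polar_plane_def)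
  then show "inversion N w \<in> A \<inter> sphere 0 1"
    using assms inversion_in_affine[of A N w] by (simp add: polar_plane_def)
qed

lemma inversion_image_polar_plane:
  assumes "affine A" "N \<in> A \<inter> sphere 0 1"
  shows "inversion N ` polar_plane A N = A \<inter> sphere 0 1 - {N}"
proof
  show "A \<inter> sphere 0 1 - {N} \<subseteq> inversion N ` polar_plane A N"
  proof
    fix z assume z: "z \<in> A \<inter> sphere 0 1 - {N}"
    then have "z = inversion N (inversion N z)" by (simp add: inversion_inversion)
    moreover have "inversion N z \<in> polar_plane A N"
      using z by (intro inversion_in_polar_plane assms) auto
    ultimately show "z \<in> inversion N ` polar_plane A N" by (rule image_eqI)
  qed
  show "inversion N ` polar_plane A N \<subseteq> A \<inter> sphere 0 1 - {N}"
    using inversion_polar_plane_sphere[OF assms] by auto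
qed

section \<open>Cutting a section of the sphere by one more half-space\<close>

lemma connected_punctured_affine_sphere:
  fixes A :: "'a::real_inner set"
  assumes "affine A" "N \<in> A \<inter> sphere 0 1"
  shows "connected (A \<inter> sphere 0 1 - {N})"
proof -
  have "continuous_on (polar_plane A N) (inversion N)"
    using assms(2) by (intro continuous_on_inversion polar_plane_neq) simp
  then have "connected (inversion N ` polar_plane A N)"
    by (intro connected_continuous_image convex_connected convex_polar_plane assms(1))
  then show ?thesis unfolding inversion_image_polar_plane[OF assms] .
qed

text \<open>Inversion at the second slice point \<open>N\<close> turns the section into the convex
  \<open>polar_plane A N\<close> and keeps the hyperplane. A small ball around the image of
  \<open>y\<close>, cut by the half-space, is then convex and hence connected. The point
  \<open>w0\<close> ensures that the half-space side is not empty.\<close>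

lemma affine_sphere_local_half:
  fixes u :: "'a::euclidean_space"
  assumes A: "affine A" and N: "N \<in> A \<inter> sphere 0 1" and y: "y \<in> A \<inter> sphere 0 1" "y \<noteq> N"
    and c: "u \<bullet> N = c" "u \<bullet> y = c"
    and w0: "w0 \<in> A \<inter> sphere 0 1" "u \<bullet> w0 > c"
    and V: "open V" "y \<in> V"
  obtains U where "open U" "y \<in> U" "U \<subseteq> V"
    "connected (A \<inter> sphere 0 1 \<inter> U \<inter> {x. u \<bullet> x > c})"
    "A \<inter> sphere 0 1 \<inter> U \<inter> {x. u \<bullet> x = c} \<subseteq> closure (A \<inter> sphere 0 1 \<inter> U \<inter> {x. u \<bullet> x > c})"
proof -
  let ?i = "inversion N"
  let ?S = "A \<inter> sphere 0 1"
  have NS: "N \<in> sphere 0 1" using N by simp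
  have cont: "continuous_on (- {N}) ?i" by (rule continuous_on_inversion) simp
  have "open (- {N} \<inter> ?i -` V)" by (rule continuous_open_preimage[OF cont _ V(1)]) auto
  moreover have "?i y \<in> - {N} \<inter> ?i -` V"
    using y V inversion_neq[of y N] inversion_inversion[of y N] by auto
  ultimately obtain e where e: "e > 0" "ball (?i y) e \<subseteq> - {N} \<inter> ?i -` V"
    by (meson openE)
  define B where "B = ball (?i y) e"
  define U where "U = - {N} \<inter> ?i -` B"
  have img: "?S \<inter> U \<inter> {x. u \<bullet> x > c} = ?i ` (polar_plane A N \<inter> B \<inter> {x. u \<bullet> x > c})"
  proof (intro equalityI subsetI)
    fix x assume x: "x \<in> ?S \<inter> U \<inter> {x. u \<bullet> x > c}"
    then have "?i x \<in> polar_plane A N \<inter> B \<inter> {x. u \<bullet> x > c}"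
      using inversion_in_polar_plane[OF A N] inversion_halfspace(1)[of x N u] c by (auto simp: U_def)
    moreover have "x = ?i (?i x)" using x inversion_inversion[of x N] by (simp add: U_def)
    ultimately show "x \<in> ?i ` (polar_plane A N \<inter> B \<inter> {x. u \<bullet> x > c})" by blast
  next
    fix x assume "x \<in> ?i ` (polar_plane A N \<inter> B \<inter> {x. u \<bullet> x > c})"
    then obtain w where w: "x = ?i w" "w \<in> polar_plane A N" "w \<in> B" "u \<bullet> w > c" by blast
    then have "w \<noteq> N" using NS polar_plane_neq by blast
    then show "x \<in> ?S \<inter> U \<inter> {x. u \<bullet> x > c}"
      using w inversion_polar_plane_sphere[OF A N w(2)] inversion_halfspace(1)[of w N u] c
      by (auto simp: U_def inversion_inversion)
  qed
  have "open U"
    unfolding U_def B_def by (rule continuous_open_preimage[OF cont]) auto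
  moreover have "y \<in> U" using y e by (simp add: U_def B_def)
  moreover have "U \<subseteq> V"
  proof
    fix x assume "x \<in> U"
    then have "x \<noteq> N" "?i (?i x) \<in> V" using e(2) by (auto simp: U_def B_def)
    then show "x \<in> V" by (simp add: inversion_inversion)
  qed
  moreover have "connected (?S \<inter> U \<inter> {x. u \<bullet> x > c})"
  proof -
  have "connected (?i ` (polar_plane A N \<inter> B \<inter> {x. u \<bullet> x > c}))"
  proof (rule connected_continuous_image)
    show "continuous_on (polar_plane A N \<inter> B \<inter> {x. u \<bullet> x > c}) ?i"
      using polar_plane_neq[OF NS] by (intro continuous_on_inversion) auto
    show "connected (polar_plane A N \<inter> B \<inter> {x. u \<bullet> x > c})"
      unfolding B_def
      by (intro convex_connected convex_Int convex_polar_plane A convex_ball convex_halfspace_gt)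
  qed
  then show ?thesis unfolding img .
  qed
  moreover have "?S \<inter> U \<inter> {x. u \<bullet> x = c} \<subseteq> closure (?S \<inter> U \<inter> {x. u \<bullet> x > c})"
  proof
    fix y' assume y': "y' \<in> ?S \<inter> U \<inter> {x. u \<bullet> x = c}"
    define w' where "w' = ?i y'"
    define w where "w = ?i w0"
    have ne: "y' \<noteq> N" "w0 \<noteq> N" using y' w0 c by (auto simp: U_def)
    have w': "w' \<in> polar_plane A N" "w' \<in> B" "u \<bullet> w' = c" "w' \<noteq> N" "?i w' = y'"
      using y' ne inversion_in_polar_plane[OF A N] inversion_halfspace(2)[of y' N u] c
      by (auto simp: w'_def U_def inversion_inversion inversion_neq)
    have w: "w \<in> polar_plane A N" "u \<bullet> w > c"
      using ne w0 inversion_in_polar_plane[OF A N] inversion_halfspace(1)[of w0 N u] c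
      by (auto simp: w_def)
    \<comment> \<open>The segment from a slice point towards the image of \<open>w0\<close>:
      \<open>u \<bullet> p s\<close> exceeds \<open>c\<close> for all positive \<open>s\<close>, and
      \<open>p s\<close> stays in \<open>B\<close> for small \<open>s\<close>, so the slice point is
      a limit of the half-space side.\<close>
    define p where "p s = w' + s *\<^sub>R (w - w')" for s :: real
    have p0: "(p \<longlongrightarrow> w') (at_right 0)"
      unfolding p_def by (auto intro!: tendsto_eq_intros)
    have "isCont ?i w'"
      using cont w'(4) by (simp add: continuous_on_eq_continuous_at open_Compl)
    then have lim: "((\<lambda>s. ?i (p s)) \<longlongrightarrow> y') (at_right 0)"
      using p0 w'(5) by (metis isCont_tendsto_compose)
    have "\<forall>\<^sub>F s in at_right 0. p s \<in> B"
      using topological_tendstoD[OF p0 _ w'(2)] by (simp add: B_def)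
    moreover have "\<forall>\<^sub>F s in at_right (0::real). s \<in> {0<..<1}"
      by (rule eventually_at_right_real) simp
    ultimately have "\<forall>\<^sub>F s in at_right 0. ?i (p s) \<in> ?S \<inter> U \<inter> {x. u \<bullet> x > c}"
    proof eventually_elim
      case (elim s)
      have "p s = (1 - s) *\<^sub>R w' + s *\<^sub>R w" by (simp add: p_def algebra_simps)
      then have "p s \<in> polar_plane A N"
        using convexD_alt[OF convex_polar_plane[OF A] w'(1) w(1), of s] elim by simp
      moreover have "u \<bullet> p s > c"
        using elim w w' by (simp add: p_def inner_add_right inner_diff_right)
      ultimately show ?case unfolding img using elim by blast
    qed
    then have "\<forall>\<^sub>F s in at_right 0. ?i (p s) \<in> closure (?S \<inter> U \<inter> {x. u \<bullet> x > c})"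
      by (rule eventually_mono) (rule subsetD[OF closure_subset])
    then show "y' \<in> closure (?S \<inter> U \<inter> {x. u \<bullet> x > c})"
      using lim by (intro Lim_in_closed_set[of _ "\<lambda>s. ?i (p s)" "at_right 0"]) auto
  qed
  ultimately show thesis by (intro that[of U])
qed

text \<open>Away from a point \<open>N\<close> other than \<open>x\<close>, the section is
  homeomorphic to a convex set; a one-point section has no such \<open>N\<close> and is treated
  apart. The lemma makes components of relatively open subsets relatively open.\<close>

lemma locally_connected_affine_sphere:
  fixes A :: "'a::euclidean_space set"
  assumes A: "affine A"
  shows "locally connected (A \<inter> sphere 0 1)"
  unfolding locally_connected
proof (intro allI impI)
  let ?S = "A \<inter> sphere 0 1"
  fix v x
  assume v: "openin (top_of_set ?S) v \<and> x \<in> v"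
  then have "x \<in> ?S" using openin_imp_subset by blast
  show "\<exists>u. openin (top_of_set ?S) u \<and> connected u \<and> x \<in> u \<and> u \<subseteq> v"
  proof (cases "?S = {x}")
    case True
    have "openin (top_of_set ?S) {x}" using openin_subtopology_self[of ?S] True by simp
    then show ?thesis using v by (intro exI[of _ "{x}"]) auto
  next
    case False
    then obtain N where N: "N \<in> ?S" "N \<noteq> x" using \<open>x \<in> ?S\<close> by blast
    have hom: "homeomorphism (polar_plane A N) (?S - {N}) (inversion N) (inversion N)"
    proof (rule homeomorphismI)
      have ne: "N \<notin> polar_plane A N" using N polar_plane_neq by blast
      show "continuous_on (polar_plane A N) (inversion N)"
        using ne by (rule continuous_on_inversion)
      show "continuous_on (?S - {N}) (inversion N)" by (intro continuous_on_inversion) simp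
      show "inversion N ` polar_plane A N \<subseteq> ?S - {N}"
        by (simp only: inversion_image_polar_plane[OF A N(1)] order_refl)
      show "inversion N ` (?S - {N}) \<subseteq> polar_plane A N"
        using inversion_in_polar_plane[OF A N(1)] by blast
      show "inversion N (inversion N w) = w" if "w \<in> polar_plane A N" for w
        using ne that by (intro inversion_inversion) blast
      show "inversion N (inversion N z) = z" if "z \<in> ?S - {N}" for z
        using that by (intro inversion_inversion) blast
    qed
    have "locally connected (?S - {N})"
    proof (rule homeomorphism_locally_imp[OF _ hom])
      show "locally connected (polar_plane A N)"
        by (intro convex_imp_locally_connected convex_polar_plane A)
    qed (metis homeomorphic_connectedness homeomorphic_def)
    moreover have "openin (top_of_set (?S - {N})) (v - {N})"
    proof -
      obtain T where "open T" "v = ?S \<inter> T" using v by (auto simp: openin_open)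
      then have "v - {N} = (?S - {N}) \<inter> T" by blast
      then show ?thesis using \<open>open T\<close> by (auto simp: openin_open)
    qed
    ultimately obtain u where u: "openin (top_of_set (?S - {N})) u" "connected u" "x \<in> u" "u \<subseteq> v - {N}"
      using v N(2) unfolding locally_connected by blast
    have "openin (top_of_set ?S) (?S - {N})"
      by (simp add: openin_delete)
    then have "openin (top_of_set ?S) u" using u(1) openin_trans by blast
    then show ?thesis using u by blast
  qed
qed

text \<open>Test points whose component before the cut misses the hyperplane stay separated in the
  uncut set, which gives \<open>m\<close>. For every other test point, its component after the cut
  has a limit point on the slice; these limit points lie in different components of the slice, which
  gives \<open>n\<close>.\<close>

lemma comps_le_halfspace_cut:
  fixes u :: "'a::euclidean_space"
  assumes A: "affine A" and V: "open V"
    and two: "\<And>y. \<lbrakk>y \<in> A \<inter> sphere 0 1; u \<bullet> y = c\<rbrakk> \<Longrightarrow> \<exists>N\<in>A \<inter> sphere 0 1. N \<noteq> y \<and> u \<bullet> N = c"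
    and m: "comps_le (A \<inter> sphere 0 1 \<inter> V) m"
    and n: "comps_le (A \<inter> sphere 0 1 \<inter> V \<inter> {x. u \<bullet> x = c}) n"
  shows "comps_le (A \<inter> sphere 0 1 \<inter> V \<inter> {x. u \<bullet> x > c}) (m + n)"
  unfolding comps_le_def
proof (intro allI impI)
  let ?S = "A \<inter> sphere 0 1" and ?h = "{x. u \<bullet> x = c}" and ?H = "{x. u \<bullet> x > c}"
  define W where "W = ?S \<inter> V"
  fix X
  assume "finite X \<and> X \<subseteq> ?S \<inter> V \<inter> ?H
    \<and> pairwise (\<lambda>x y. \<not> connected_component (?S \<inter> V \<inter> ?H) x y) X"
  then have fin: "finite X" and XW: "X \<subseteq> W \<inter> ?H"
    and sep: "\<And>x x'. \<lbrakk>x \<in> X; x' \<in> X; connected_component (W \<inter> ?H) x x'\<rbrakk> \<Longrightarrow> x = x'"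
    by (auto simp: W_def pairwise_def)
  define C where "C x = connected_component_set (W \<inter> ?H) x" for x
  have CW: "C x \<subseteq> W \<inter> ?H" for x
    unfolding C_def by (rule connected_component_subset)
  \<comment> \<open>\<open>x\<close> enters only as a witness that the half-space meets the
    section.\<close>
  have local: "\<exists>U. open U \<and> y \<in> U \<and> connected (W \<inter> U \<inter> ?H) \<and> W \<inter> U \<inter> ?h \<subseteq> closure (W \<inter> U \<inter> ?H)"
    if y: "y \<in> W \<inter> ?h" and x: "x \<in> X" for x y
  proof -
    obtain N where N: "N \<in> ?S" "N \<noteq> y" "u \<bullet> N = c" using two[of y] y by (auto simp: W_def)
    have "y \<in> ?S" "y \<in> V" "u \<bullet> y = c" "x \<in> ?S" "u \<bullet> x > c" using y x XW by (auto simp: W_def)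
    then obtain U where U: "open U" "y \<in> U" "U \<subseteq> V"
      "connected (?S \<inter> U \<inter> ?H)" "?S \<inter> U \<inter> ?h \<subseteq> closure (?S \<inter> U \<inter> ?H)"
      using affine_sphere_local_half[OF A N(1) _ _ N(3), of y x V] N V by metis
    moreover have "?S \<inter> U = W \<inter> U" using U(3) by (auto simp: W_def)
    ultimately show ?thesis by metis
  qed
  \<comment> \<open>The neighbourhood \<open>U\<close> of an adherent point meets
    \<open>C x\<close>, and the connected piece of the half-space side in \<open>U\<close> lies in a
    single component.\<close>
  have absorb: "W \<inter> U \<inter> ?H \<subseteq> C x"
    if "y \<in> closure (C x)" "open U" "y \<in> U" "connected (W \<inter> U \<inter> ?H)" for x y U
  proof -
    have "U \<inter> C x \<noteq> {}" using that open_Int_closure_eq_empty[of U "C x"] by blast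
    then obtain z where z: "z \<in> U" "z \<in> C x" by blast
    then have "z \<in> W \<inter> U \<inter> ?H" using CW by blast
    then have "W \<inter> U \<inter> ?H \<subseteq> connected_component_set (W \<inter> ?H) z"
      by (intro connected_component_maximal that(4)) auto
    also have "\<dots> = C x" using z(2) unfolding C_def by (rule connected_component_eq)
    finally show ?thesis .
  qed
  \<comment> \<open>Adherence to \<open>C x\<close> is locally constant on the slice: the local
    piece is absorbed by \<open>C x\<close> and has all nearby slice points in its closure. So it is
    constant on each component of the slice.\<close>
  have spread: "y' \<in> closure (C x)"
    if D: "connected_component (W \<inter> ?h) y y'" and y: "y \<in> closure (C x)" and x: "x \<in> X" for x y y'
  proof -
    let ?R = "\<lambda>a b. a \<in> closure (C x) \<longleftrightarrow> b \<in> closure (C x)"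
    define D where "D = connected_component_set (W \<inter> ?h) y"
    have DW: "D \<subseteq> W \<inter> ?h" unfolding D_def by (rule connected_component_subset)
    have "y \<in> W \<inter> ?h" using D connected_component_in by fast
    then have "y \<in> D" "y' \<in> D" using D by (auto simp: D_def)
    have "connected D" by (simp add: D_def)
    then have "?R y y'" using \<open>y \<in> D\<close> \<open>y' \<in> D\<close>
    proof (rule connected_equivalence_relation)
      fix a assume a: "a \<in> D"
      then have "a \<in> W \<inter> ?h" using DW by blast
      then obtain U where U: "open U" "a \<in> U" "connected (W \<inter> U \<inter> ?H)"
        "W \<inter> U \<inter> ?h \<subseteq> closure (W \<inter> U \<inter> ?H)"
        using local x by blast
      have "b \<in> closure (C x)" if "a' \<in> D \<inter> U" "a' \<in> closure (C x)" "b \<in> D \<inter> U" for a' b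
      proof -
        have "W \<inter> U \<inter> ?H \<subseteq> C x" using absorb that U by blast
        then have "closure (W \<inter> U \<inter> ?H) \<subseteq> closure (C x)" by (rule closure_mono)
        then show ?thesis using U(4) that(3) DW by blast
      qed
      then have "\<forall>b\<in>D \<inter> U. ?R a b" using a U(2) by blast
      moreover have "openin (top_of_set D) (D \<inter> U)" using U(1) by (rule openin_open_Int)
      ultimately show "\<exists>T. openin (top_of_set D) T \<and> a \<in> T \<and> (\<forall>b\<in>T. ?R a b)"
        using a U(2) by blast
    qed auto
    then show ?thesis using y by blast
  qed
  \<comment> \<open>Both components absorb the same nonempty local piece, so they coincide.\<close>
  have common: "x = x'"
    if y: "y \<in> W \<inter> ?h" "y \<in> closure (C x)" "y \<in> closure (C x')" and x: "x \<in> X" "x' \<in> X" for x x' y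
  proof -
    obtain U where U: "open U" "y \<in> U" "connected (W \<inter> U \<inter> ?H)"
      "W \<inter> U \<inter> ?h \<subseteq> closure (W \<inter> U \<inter> ?H)"
      using local[OF y(1) x(1)] by blast
    then have "y \<in> closure (W \<inter> U \<inter> ?H)" using y(1) by blast
    then have "W \<inter> U \<inter> ?H \<noteq> {}" by (metis closure_empty empty_iff)
    then obtain z where "z \<in> W \<inter> U \<inter> ?H" by blast
    then have "z \<in> C x" "z \<in> C x'" using absorb U(1-3) y by blast+
    then have "connected_component (W \<inter> ?H) x x'"
      unfolding C_def by (metis connected_component_sym connected_component_trans mem_Collect_eq)
    then show ?thesis by (rule sep[OF x])
  qed
  define X1 where "X1 = {x \<in> X. connected_component_set W x \<inter> ?h = {}}"
  define X2 where "X2 = X - X1"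
  have "card X1 \<le> m"
  proof (rule comps_leD[OF m])
    show "finite X1" "X1 \<subseteq> ?S \<inter> V" using fin XW by (auto simp: X1_def W_def)
    show "pairwise (\<lambda>x y. \<not> connected_component (?S \<inter> V) x y) X1"
      unfolding W_def[symmetric]
    proof (rule pairwiseI, rule notI)
      fix x x' assume x: "x \<in> X1" "x' \<in> X1" "x \<noteq> x'" "connected_component W x x'"
      define D where "D = connected_component_set W x"
      have xD: "x \<in> D" "x' \<in> D" "D \<subseteq> W" "D \<inter> ?h = {}" "connected D"
        using x XW connected_component_subset[of W x] by (auto simp: D_def X1_def)
      \<comment> \<open>A connected set that avoids the hyperplane stays on the side of its point
        \<open>x\<close>.\<close>
      have "D \<subseteq> ?H"
      proof (rule ccontr)
        assume "\<not> D \<subseteq> ?H"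
        then obtain z where "z \<in> D" "u \<bullet> z \<le> c" by (metis mem_Collect_eq not_le subsetI)
        moreover have "u \<bullet> x \<ge> c" using x XW by (auto simp: X1_def)
        ultimately obtain w where "w \<in> D" "u \<bullet> w = c"
          using connected_ivt_hyperplane[OF xD(5), of z x u c] xD(1) by blast
        then show False using xD by blast
      qed
      then have "connected_component (W \<inter> ?H) x x'"
        unfolding connected_component_def using xD by blast
      then show False using sep[of x x'] x by (auto simp: X1_def)
    qed
  qed
  moreover have "card X2 \<le> n"
  proof -
    \<comment> \<open>Without such a limit point, every limit of \<open>C x\<close> inside
      \<open>W\<close> lies strictly in the half-space and so in \<open>C x\<close>. Together with
      local connectedness this makes \<open>C x\<close> both open and closed in the connected
      \<open>D\<close>, although \<open>D\<close> meets the hyperplane and \<open>C x\<close> does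
      not.\<close>
    have ex: "\<exists>y. y \<in> W \<inter> ?h \<and> y \<in> closure (C x)" if x: "x \<in> X2" for x
    proof (rule ccontr)
      assume no: "\<nexists>y. y \<in> W \<inter> ?h \<and> y \<in> closure (C x)"
      define D where "D = connected_component_set W x"
      have xX: "x \<in> X" "x \<in> W \<inter> ?H" using x XW by (auto simp: X2_def)
      obtain z where z: "z \<in> D" "u \<bullet> z = c" using x by (auto simp: X2_def X1_def D_def)
      have "connected D" by (simp add: D_def)
      have DW: "D \<subseteq> W" unfolding D_def by (rule connected_component_subset)
      have xC: "x \<in> C x" using xX by (simp add: C_def)
      have CD: "C x \<subseteq> D" unfolding D_def C_def by (rule connected_component_mono) auto
      define Z where "Z = D \<inter> closure (C x)"
      have Zge: "w \<in> C x" if "w \<in> Z" for w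
      proof -
        have "w \<in> W" "w \<in> closure (C x)" using that DW by (auto simp: Z_def)
        moreover have "closure (C x) \<subseteq> {x. u \<bullet> x \<ge> c}"
          using CW by (intro closure_minimal closed_halfspace_ge) force
        ultimately have "w \<in> W \<inter> ?H" using no by force
        have "connected (C x)" by (simp add: C_def)
        moreover have "insert w (C x) \<subseteq> closure (C x)"
          using \<open>w \<in> closure (C x)\<close> closure_subset[of "C x"] by blast
        ultimately have "connected (insert w (C x))"
          using connected_intermediate_closure by blast
        then have "insert w (C x) \<subseteq> connected_component_set (W \<inter> ?H) x"
          using xC CW \<open>w \<in> W \<inter> ?H\<close> by (intro connected_component_maximal) auto
        then show ?thesis by (simp add: C_def)
      qed
      then have ZC: "Z = C x" using CD closure_subset by (auto simp: Z_def)
      have "closedin (top_of_set D) Z" unfolding Z_def by (intro closedin_closed_Int) simp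
      moreover have "openin (top_of_set D) Z"
      proof -
        have "openin (top_of_set ?S) (W \<inter> ?H)"
          unfolding W_def using V
          by (metis Int_assoc open_Int open_halfspace_gt openin_open_Int)
        then have "locally connected (W \<inter> ?H)"
          using locally_connected_affine_sphere[OF A] locally_open_subset by blast
        then have "openin (top_of_set (W \<inter> ?H)) (C x)"
          unfolding C_def by (rule openin_connected_component_locally_connected)
        then obtain T where T: "open T" "C x = W \<inter> ?H \<inter> T" by (auto simp: openin_open)
        have "open (?H \<inter> T)" using T(1) by (intro open_Int open_halfspace_gt)
        moreover have "Z = D \<inter> (?H \<inter> T)" unfolding ZC using T(2) CD DW by blast
        ultimately show ?thesis using openin_open by blast
      qed
      ultimately have "Z = {} \<or> Z = D"
        using \<open>connected D\<close> unfolding connected_clopen by blast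
      then have "z \<in> C x" using ZC xC z by blast
      then show False using CW z by force
    qed
    then obtain g where g: "\<And>x. x \<in> X2 \<Longrightarrow> g x \<in> W \<inter> ?h \<and> g x \<in> closure (C x)" by metis
    have gsep: "x = x'" if "x \<in> X2" "x' \<in> X2" "connected_component (W \<inter> ?h) (g x) (g x')" for x x'
      using spread[OF that(3), of x] common[of "g x'" x x'] g that by (auto simp: X2_def)
    have inj: "inj_on g X2"
    proof (rule inj_onI)
      fix x x' assume "x \<in> X2" "x' \<in> X2" "g x = g x'"
      then show "x = x'" using gsep[of x x'] g by (metis connected_component_refl)
    qed
    have "card (g ` X2) \<le> n"
    proof (rule comps_leD[OF n])
      show "finite (g ` X2)" using fin by (simp add: X2_def)
      show "g ` X2 \<subseteq> ?S \<inter> V \<inter> ?h" using g by (auto simp: W_def)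
      show "pairwise (\<lambda>x y. \<not> connected_component (?S \<inter> V \<inter> ?h) x y) (g ` X2)"
        unfolding W_def[symmetric] using gsep by (auto simp: pairwise_def)
    qed
    then show ?thesis by (simp add: card_image[OF inj])
  qed
  moreover have "card X \<le> card X1 + card X2"
  proof -
    have "X = X1 \<union> X2" by (auto simp: X1_def X2_def)
    then show ?thesis by (metis card_Un_le)
  qed
  ultimately show "card X \<le> m + n" by linarith
qed

section \<open>The component bound by induction over half-spaces and dimensions\<close>

lemma aff_dim_le_0_unique:
  assumes "aff_dim S \<le> 0" "x \<in> S" "y \<in> S"
  shows "x = y"
proof -
  have "aff_dim S = 0"
    using assms(1,2) aff_dim_geq[of S] aff_dim_empty[of S] by force
  then show ?thesis using assms(2,3) aff_dim_eq_0[of S] by auto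
qed

lemma aff_dim_Int_hyperplane_less:
  fixes A :: "'a::euclidean_space set"
  assumes "affine A" "z \<in> A" "u \<bullet> z \<noteq> c"
  shows "aff_dim (A \<inter> {x. u \<bullet> x = c}) \<le> aff_dim A - 1"
proof -
  have "\<not> A \<subseteq> {x. u \<bullet> x = c}" using assms(2,3) by blast
  moreover have "0 \<le> aff_dim A" using assms(2) aff_dim_geq[of A] aff_dim_empty[of A] by force
  ultimately show ?thesis
    using aff_dim_affine_Int_hyperplane[OF assms(1), of u c] by auto
qed

text \<open>Of three separated points, deleting one would leave the other two in a connected set.
  The two-point sphere attains the bound 2.\<close>

lemma comps_le_two_if_connected_delete:
  assumes "\<And>p. p \<in> S \<Longrightarrow> connected (S - {p})"
  shows "comps_le S 2"
  unfolding comps_le_def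
proof (intro allI impI)
  fix X
  assume X: "finite X \<and> X \<subseteq> S \<and> pairwise (\<lambda>x y. \<not> connected_component S x y) X"
  show "card X \<le> 2"
  proof (rule ccontr)
    assume "\<not> card X \<le> 2"
    then obtain p where p: "p \<in> X" by (metis all_not_in_conv card.empty zero_le)
    have "1 < card (X - {p})" using \<open>\<not> card X \<le> 2\<close> X p by (simp add: card_Diff_singleton)
    then obtain x y where xy: "x \<in> X" "y \<in> X" "x \<noteq> p" "y \<noteq> p" "x \<noteq> y"
      using card_le_Suc0_iff_eq[of "X - {p}"] X by (auto simp: not_le[symmetric])
    have "connected_component S x y"
      unfolding connected_component_def
      using assms[of p] xy p X by (intro exI[of _ "S - {p}"]) blast
    then show False using X xy by (auto simp: pairwise_def)
  qed
qed

text \<open>Inversion at one of three points sends the other two into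
  \<open>polar_plane A N\<close>. This is at most a point, because \<open>N\<close> lies in
  \<open>A\<close> but off the hyperplane, so the dimension drops.\<close>

lemma card_affine_sphere_le:
  fixes A :: "'a::euclidean_space set"
  assumes A: "affine A" "aff_dim A \<le> 1" and X: "finite X" "X \<subseteq> A \<inter> sphere 0 1"
  shows "card X \<le> 2"
proof (rule ccontr)
  assume "\<not> card X \<le> 2"
  then obtain N where N: "N \<in> X" by (metis all_not_in_conv card.empty zero_le)
  have "1 < card (X - {N})" using \<open>\<not> card X \<le> 2\<close> X N by (simp add: card_Diff_singleton)
  then obtain x y where xy: "x \<in> X" "y \<in> X" "x \<noteq> N" "y \<noteq> N" "x \<noteq> y"
    using card_le_Suc0_iff_eq[of "X - {N}"] X by (auto simp: not_le[symmetric])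
  have NS: "N \<in> A \<inter> sphere 0 1" using N X by blast
  have "N \<in> A" "N \<bullet> N \<noteq> 1/2" using NS by (auto simp: norm_eq_1)
  then have "aff_dim (polar_plane A N) \<le> 0"
    using aff_dim_Int_hyperplane_less[OF A(1), of N N "1/2"] A(2) by (simp add: polar_plane_def)
  moreover have "inversion N x \<in> polar_plane A N" "inversion N y \<in> polar_plane A N"
    using xy X by (auto intro!: inversion_in_polar_plane[OF A(1) NS])
  ultimately have "inversion N x = inversion N y" by (rule aff_dim_le_0_unique)
  then show False using xy inversion_inversion[of x N] inversion_inversion[of y N] by simp
qed

text \<open>Three parallel hyperplanes cannot all be tangent: the sphere minus the middle tangency
  point is connected and contains the other two tangency points on different sides.\<close>

lemma generic_level:
  fixes u :: "'a::euclidean_space"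
  assumes A: "affine A" and "a < b"
  obtains c where "a < c" "c < b"
    "\<And>y. \<lbrakk>y \<in> A \<inter> sphere 0 1; u \<bullet> y = c\<rbrakk> \<Longrightarrow> \<exists>N\<in>A \<inter> sphere 0 1. N \<noteq> y \<and> u \<bullet> N = c"
proof -
  let ?S = "A \<inter> sphere 0 1"
  define ok where "ok c \<longleftrightarrow> (\<forall>y\<in>?S. u \<bullet> y = c \<longrightarrow> (\<exists>N\<in>?S. N \<noteq> y \<and> u \<bullet> N = c))" for c
  obtain c2 where c2: "a < c2" "c2 < b" using dense[OF \<open>a < b\<close>] by blast
  obtain c1 where c1: "a < c1" "c1 < c2" using dense[OF c2(1)] by blast
  obtain c3 where c3: "c2 < c3" "c3 < b" using dense[OF c2(2)] by blast
  have "ok c1 \<or> ok c2 \<or> ok c3"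
  proof (rule ccontr)
    assume no: "\<not> (ok c1 \<or> ok c2 \<or> ok c3)"
    then obtain y1 y2 y3 where y: "y1 \<in> ?S" "u \<bullet> y1 = c1" "y3 \<in> ?S" "u \<bullet> y3 = c3"
      "y2 \<in> ?S" "u \<bullet> y2 = c2" "\<And>N. \<lbrakk>N \<in> ?S; N \<noteq> y2\<rbrakk> \<Longrightarrow> u \<bullet> N \<noteq> c2"
      unfolding ok_def by blast
    have "\<exists>z\<in>?S - {y2}. u \<bullet> z = c2"
      using connected_ivt_hyperplane[OF connected_punctured_affine_sphere[OF A y(5)], of y1 y3 u c2]
        y c1 c3 by auto
    then show False using y(7) by blast
  qed
  then obtain c where "a < c" "c < b" "ok c"
    using c1 c2 c3 by (meson order_less_trans)
  then show thesis using that by (auto simp: ok_def)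
qed

text \<open>\<open>k\<close> bounds the dimension of the sphere. \<open>A\<close> and
  \<open>k\<close> vary in the induction because the slice is a section of smaller dimension cut by
  the same \<open>F\<close>. With \<open>n = card F + 1\<close> the recursion closes by
  \<open>2 * n ^ k + 2 * n ^ (k - 1) = 2 * (n + 1) * n ^ (k - 1)\<close>, which is at most
  \<open>2 * (n + 1) ^ k\<close>; the factor 2 comes from the uncut sphere and from dimension
  0.\<close>

lemma comps_le_sphere_Int_halfspaces:
  fixes A :: "'a::euclidean_space set" and F :: "('a \<times> real) set"
  assumes "finite F" "affine A" "aff_dim A \<le> int k + 1"
  shows "comps_le (A \<inter> sphere 0 1 \<inter> (\<Inter>(u, c)\<in>F. {x. u \<bullet> x > c})) (2 * (card F + 1) ^ k)"
  using assms
proof (induction F arbitrary: A k rule: finite_induct)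
  case empty
  then have "comps_le (A \<inter> sphere 0 1) 2"
    by (intro comps_le_two_if_connected_delete connected_punctured_affine_sphere)
  then show ?case by simp
next
  case (insert h F)
  obtain u c where h: "h = (u, c)" by fastforce
  let ?S = "A \<inter> sphere 0 1"
  define V where "V = (\<Inter>(u, c)\<in>F. {x. u \<bullet> x > c})"
  have V: "open V" unfolding V_def using insert.hyps(1)
    by (intro open_INT) (auto simp: open_halfspace_gt)
  have goal_eq: "?S \<inter> (\<Inter>(u, c)\<in>insert h F. {x. u \<bullet> x > c}) = ?S \<inter> V \<inter> {x. u \<bullet> x > c}"
    by (auto simp: h V_def)
  show ?case
    unfolding comps_le_def goal_eq
  proof (intro allI impI)
    fix X
    assume X: "finite X \<and> X \<subseteq> ?S \<inter> V \<inter> {x. u \<bullet> x > c}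
      \<and> pairwise (\<lambda>x y. \<not> connected_component (?S \<inter> V \<inter> {x. u \<bullet> x > c}) x y) X"
    show "card X \<le> 2 * (card (insert h F) + 1) ^ k"
    proof (cases "k = 0 \<or> X = {}")
      case True
      moreover have "card X \<le> 2" if "k = 0"
        using that X insert.prems by (intro card_affine_sphere_le[of A]) auto
      ultimately show ?thesis by auto
    next
      case False
      \<comment> \<open>Every level between \<open>c\<close> and this minimum keeps all of
        \<open>X\<close> in the cut set.\<close>
      define b where "b = Min ((\<lambda>x. u \<bullet> x) ` X)"
      have b: "c < b" "\<And>x. x \<in> X \<Longrightarrow> b \<le> u \<bullet> x"
        using X False by (auto simp: b_def subset_iff)
      obtain c' where c': "c < c'" "c' < b"
        and two: "\<And>y. \<lbrakk>y \<in> ?S; u \<bullet> y = c'\<rbrakk> \<Longrightarrow> \<exists>N\<in>?S. N \<noteq> y \<and> u \<bullet> N = c'"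
        using generic_level[OF insert.prems(1) b(1)] by metis
      have XH: "X \<subseteq> ?S \<inter> V \<inter> {x. u \<bullet> x > c'}" using X b(2) c'(2) by fastforce
      \<comment> \<open>\<open>x0\<close> lies strictly above level \<open>c'\<close>, so the
        hyperplane does not contain \<open>A\<close> and the slice loses a dimension.\<close>
      obtain x0 where x0: "x0 \<in> X" using False by blast
      obtain j where j: "k = Suc j" using False by (cases k) auto
      let ?n = "card F + 1"
      have "comps_le (?S \<inter> V) (2 * ?n ^ k)"
        using insert.IH[OF insert.prems] by (simp add: V_def)
      moreover have "comps_le (?S \<inter> V \<inter> {x. u \<bullet> x = c'}) (2 * ?n ^ j)"
      proof -
        have "aff_dim (A \<inter> {x. u \<bullet> x = c'}) \<le> int j + 1"
          using aff_dim_Int_hyperplane_less[OF insert.prems(1), of x0 u c'] XH x0 insert.prems(2) j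
          by fastforce
        then have "comps_le (A \<inter> {x. u \<bullet> x = c'} \<inter> sphere 0 1 \<inter> V) (2 * ?n ^ j)"
          unfolding V_def using insert.prems(1)
          by (intro insert.IH affine_Int affine_hyperplane)
        moreover have "A \<inter> {x. u \<bullet> x = c'} \<inter> sphere 0 1 \<inter> V = ?S \<inter> V \<inter> {x. u \<bullet> x = c'}"
          by blast
        ultimately show ?thesis by simp
      qed
      ultimately have "comps_le (?S \<inter> V \<inter> {x. u \<bullet> x > c'}) (2 * ?n ^ k + 2 * ?n ^ j)"
        by (intro comps_le_halfspace_cut insert.prems(1) V two)
      then have "card X \<le> 2 * ?n ^ k + 2 * ?n ^ j"
      proof (rule comps_leD)
        show "pairwise (\<lambda>x y. \<not> connected_component (?S \<inter> V \<inter> {x. u \<bullet> x > c'}) x y) X"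
        proof (rule pairwiseI, rule notI)
          fix x y
          assume xy: "x \<in> X" "y \<in> X" "x \<noteq> y"
            and cc: "connected_component (?S \<inter> V \<inter> {x. u \<bullet> x > c'}) x y"
          have "?S \<inter> V \<inter> {x. u \<bullet> x > c'} \<subseteq> ?S \<inter> V \<inter> {x. u \<bullet> x > c}" using c'(1) by auto
          then have "connected_component (?S \<inter> V \<inter> {x. u \<bullet> x > c}) x y"
            by (rule connected_component_of_subset[OF cc])
          then show False using X xy by (auto simp: pairwise_def)
        qed
      qed (use X XH in auto)
      also have "\<dots> = 2 * ((?n + 1) * ?n ^ j)" by (simp add: j algebra_simps)
      also have "\<dots> \<le> 2 * ((?n + 1) * (?n + 1) ^ j)"
        by (intro mult_le_mono le_refl power_mono) auto
      also have "\<dots> = 2 * (card (insert h F) + 1) ^ k"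
        using insert.hyps by (simp add: j)
      finally show ?thesis .
    qed
  qed
qed

section \<open>The Klein model\<close>

lemma dist_hyp_less_iff: "0 \<le> r \<Longrightarrow> dist x y < r \<longleftrightarrow> lorentz (Rep_hyp x) (Rep_hyp y) < cosh r"
  using arcosh_less_iff_real[of "lorentz (Rep_hyp x) (Rep_hyp y)" "cosh r"]
    lorentz_hyp_ge_1[of x y] cosh_real_ge_1[of r]
  by (simp add: dist_hyp_def arcosh_cosh_real)

lemma dist_hyp_greater_iff: "0 \<le> r \<Longrightarrow> r < dist x y \<longleftrightarrow> cosh r < lorentz (Rep_hyp x) (Rep_hyp y)"
  using arcosh_less_iff_real[of "cosh r" "lorentz (Rep_hyp x) (Rep_hyp y)"]
    lorentz_hyp_ge_1[of x y] cosh_real_ge_1[of r]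
  by (simp add: dist_hyp_def arcosh_cosh_real)

lemma Rep_hyp_origin: "Rep_hyp origin = (0, 1)"
  unfolding origin_def by (rule Abs_hyp_inverse) (simp add: lorentz_def)

text \<open>The Klein model: central projection of the hyperboloid to the hyperplane at height 1,
  in which geodesics are straight and balls are convex.\<close>

definition klein :: "real^'d::finite \<Rightarrow> 'd hyp" where
  "klein k = Abs_hyp ((1 / sqrt (1 - (norm k)\<^sup>2)) *\<^sub>R (k, 1))"

lemma klein_sqrt_pos: "norm k < 1 \<Longrightarrow> 0 < sqrt (1 - (norm k)\<^sup>2)"
  by (simp add: abs_square_less_1)

lemma Rep_hyp_klein:
  assumes "norm k < 1"
  shows "Rep_hyp (klein k) = (1 / sqrt (1 - (norm k)\<^sup>2)) *\<^sub>R (k, 1)"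
  unfolding klein_def
proof (rule Abs_hyp_inverse, rule CollectI, rule conjI)
  have p: "0 < sqrt (1 - (norm k)\<^sup>2)" by (rule klein_sqrt_pos[OF assms])
  then show "0 < snd ((1 / sqrt (1 - (norm k)\<^sup>2)) *\<^sub>R (k, 1::real))" by simp
  have "lorentz (k, 1) (k, 1) = (sqrt (1 - (norm k)\<^sup>2))\<^sup>2"
    using p by (simp add: lorentz_def power2_norm_eq_inner)
  then show "lorentz ((1 / sqrt (1 - (norm k)\<^sup>2)) *\<^sub>R (k, 1)) ((1 / sqrt (1 - (norm k)\<^sup>2)) *\<^sub>R (k, 1)) = 1"
    unfolding lorentz_scaleR_left lorentz_scaleR_right using p by (simp add: power2_eq_square)
qed

lemma lorentz_klein:
  "norm k < 1 \<Longrightarrow>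
    lorentz (Rep_hyp (klein k)) (Rep_hyp y) = lorentz (k, 1) (Rep_hyp y) / sqrt (1 - (norm k)\<^sup>2)"
  by (simp add: Rep_hyp_klein lorentz_scaleR_left del: scaleR_Pair)

lemma klein_surj:
  obtains k where "norm k < 1" "x = klein k"
proof -
  obtain p s where X: "Rep_hyp x = (p, s)" by fastforce
  have s: "0 < s" "s * s = 1 + p \<bullet> p" using Rep_hyp[of x] X by (auto simp: lorentz_def)
  define k where "k = (1 / s) *\<^sub>R p"
  have "(norm k)\<^sup>2 = (p \<bullet> p) / (s * s)"
    using s(1) by (simp add: k_def power_divide power2_norm_eq_inner flip: power2_eq_square)
  also have "\<dots> = 1 - 1 / (s * s)" using s(2) mult_pos_pos[OF s(1) s(1)] by (simp add: field_simps del: mult_pos_pos)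
  finally have n: "(norm k)\<^sup>2 = 1 - 1 / (s * s)" .
  then have "(norm k)\<^sup>2 < 1" using s(1) by simp
  then have k: "norm k < 1" by (simp add: abs_square_less_1)
  have "sqrt (1 - (norm k)\<^sup>2) = 1 / s" using n s(1) by (simp add: real_sqrt_divide)
  then have "Rep_hyp (klein k) = Rep_hyp x"
    using s(1) unfolding Rep_hyp_klein[OF k] by (simp add: X k_def)
  then show thesis using k that by (simp add: Rep_hyp_inject)
qed

text \<open>Clearing the positive denominator leaves a comparison that is affine in the hemisphere
  point \<open>(k, sqrt (1 - (norm k)\<^sup>2))\<close>.\<close>

lemma klein_dist_less_iff:
  assumes "norm k < 1" "0 \<le> r"
  shows "dist (klein k) y < r \<longleftrightarrow> lorentz (k, 1) (Rep_hyp y) < cosh r * sqrt (1 - (norm k)\<^sup>2)"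
  using klein_sqrt_pos[OF assms(1)]
  by (simp add: dist_hyp_less_iff[OF assms(2)] lorentz_klein[OF assms(1)] pos_divide_less_eq)

lemma klein_dist_greater_iff:
  assumes "norm k < 1" "0 \<le> r"
  shows "r < dist (klein k) y \<longleftrightarrow> cosh r * sqrt (1 - (norm k)\<^sup>2) < lorentz (k, 1) (Rep_hyp y)"
  using klein_sqrt_pos[OF assms(1)]
  by (simp add: dist_hyp_greater_iff[OF assms(2)] lorentz_klein[OF assms(1)] pos_less_divide_eq)

lemma continuous_on_klein: "continuous_on (ball 0 1) (klein :: real^'d::finite \<Rightarrow> 'd hyp)"
  unfolding continuous_on_def
proof
  fix k :: "real^'d" assume k: "k \<in> ball 0 1"
  have eq: "dist (klein k') (klein k) = arcosh (lorentz (k', 1) (Rep_hyp (klein k)) / sqrt (1 - (norm k')\<^sup>2))"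
    if "k' \<in> ball 0 1" for k'
    using that by (simp add: dist_hyp_def lorentz_klein)
  have "((\<lambda>k'. lorentz (k', 1) (Rep_hyp (klein k)) / sqrt (1 - (norm k')\<^sup>2))
      \<longlongrightarrow> lorentz (k, 1) (Rep_hyp (klein k)) / sqrt (1 - (norm k)\<^sup>2)) (at k within ball 0 1)"
    using klein_sqrt_pos[of k] k unfolding lorentz_def by (auto intro!: tendsto_eq_intros)
  also have "lorentz (k, 1) (Rep_hyp (klein k)) / sqrt (1 - (norm k)\<^sup>2) = 1"
    using k by (simp add: lorentz_klein[symmetric] lorentz_hyp_self)
  finally have lim: "((\<lambda>k'. lorentz (k', 1) (Rep_hyp (klein k)) / sqrt (1 - (norm k')\<^sup>2)) \<longlongrightarrow> 1)
      (at k within ball 0 1)" .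
  have "((\<lambda>k'. arcosh (lorentz (k', 1) (Rep_hyp (klein k)) / sqrt (1 - (norm k')\<^sup>2))) \<longlongrightarrow> arcosh 1)
      (at k within ball 0 1)"
  \<comment> \<open>The limit 1 is the endpoint of the domain of \<open>arcosh\<close>, so the
    approach must be from above; \<open>lorentz_hyp_ge_1\<close> provides this.\<close>
  proof (rule tendsto_arcosh_strong[OF lim])
    show "\<forall>\<^sub>F k' in at k within ball 0 1.
        1 \<le> lorentz (k', 1) (Rep_hyp (klein k)) / sqrt (1 - (norm k')\<^sup>2)"
      unfolding eventually_at_filter
      by (auto simp: lorentz_klein[symmetric] lorentz_hyp_ge_1)
  qed simp
  then have "((\<lambda>k'. dist (klein k') (klein k)) \<longlongrightarrow> arcosh 1) (at k within ball 0 1)"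
    by (rule Lim_transform_eventually) (simp add: eventually_at_filter eq)
  then show "(klein \<longlongrightarrow> klein k) (at k within ball 0 1)"
    unfolding tendsto_dist_iff[of klein] by simp
qed

text \<open>A convex combination of two points of the unit sphere stays in the unit ball, so its
  height is at most that of the sphere over the same base point. A Klein ball is therefore the set
  where an affine function is below a concave one, which is convex.\<close>

lemma concave_hemisphere:
  fixes a b :: "'a::real_inner"
  assumes "norm a \<le> 1" "norm b \<le> 1" "0 \<le> s" "0 \<le> t" "s + t = 1"
  shows "s * sqrt (1 - (norm a)\<^sup>2) + t * sqrt (1 - (norm b)\<^sup>2) \<le> sqrt (1 - (norm (s *\<^sub>R a + t *\<^sub>R b))\<^sup>2)"
proof -
  let ?p = "\<lambda>x::'a. (x, sqrt (1 - (norm x)\<^sup>2))"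
  have 1: "norm (?p x) = 1" if "norm x \<le> 1" for x :: 'a
    using that by (simp add: norm_Pair abs_square_le_1)
  have "norm (s *\<^sub>R ?p a + t *\<^sub>R ?p b) \<le> s * norm (?p a) + t * norm (?p b)"
    using assms(3,4) norm_triangle_ineq[of "s *\<^sub>R ?p a" "t *\<^sub>R ?p b"]
    by (simp only: norm_scaleR abs_of_nonneg)
  then have "norm (s *\<^sub>R ?p a + t *\<^sub>R ?p b) \<le> 1"
    using 1 assms by simp
  then have "(norm (s *\<^sub>R a + t *\<^sub>R b))\<^sup>2
      + (s * sqrt (1 - (norm a)\<^sup>2) + t * sqrt (1 - (norm b)\<^sup>2))\<^sup>2 \<le> 1"
    by (simp add: norm_Pair)
  then show ?thesis by (intro real_le_rsqrt) simp
qed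

lemma convex_comb_klein:
  fixes a b :: "real^'d::finite"
  assumes "norm a < 1" "norm b < 1" "0 \<le> s" "0 \<le> t" "s + t = 1"
  shows "norm (s *\<^sub>R a + t *\<^sub>R b) < 1"
    and "lorentz (s *\<^sub>R a + t *\<^sub>R b, 1) y = s * lorentz (a, 1) y + t * lorentz (b, 1) y"
    and "0 \<le> C \<Longrightarrow> C * (s * sqrt (1 - (norm a)\<^sup>2) + t * sqrt (1 - (norm b)\<^sup>2))
      \<le> C * sqrt (1 - (norm (s *\<^sub>R a + t *\<^sub>R b))\<^sup>2)"
proof -
  show "norm (s *\<^sub>R a + t *\<^sub>R b) < 1"
    using convexD[OF convex_ball[of "0::real^'d" 1], of a b s t] assms by simp
  have "(s *\<^sub>R a + t *\<^sub>R b, 1) = s *\<^sub>R (a, 1) + t *\<^sub>R (b, 1::real)" using assms(5) by simp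
  then show "lorentz (s *\<^sub>R a + t *\<^sub>R b, 1) y = s * lorentz (a, 1) y + t * lorentz (b, 1) y"
    by (simp only: lorentz_add_left lorentz_scaleR_left)
  show "C * (s * sqrt (1 - (norm a)\<^sup>2) + t * sqrt (1 - (norm b)\<^sup>2))
      \<le> C * sqrt (1 - (norm (s *\<^sub>R a + t *\<^sub>R b))\<^sup>2)" if "0 \<le> C"
    using that assms by (intro mult_left_mono concave_hemisphere) auto
qed

lemma convex_klein_ball:
  assumes "0 \<le> r"
  shows "convex {k. norm k < 1 \<and> dist (klein k) y < r}"
proof (rule convexI)
  fix a b and s t :: real
  assume ab: "a \<in> {k. norm k < 1 \<and> dist (klein k) y < r}" "b \<in> {k. norm k < 1 \<and> dist (klein k) y < r}"
    and st: "0 \<le> s" "0 \<le> t" "s + t = 1"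
  have n: "norm a < 1" "norm b < 1" using ab by auto
  note cc = convex_comb_klein[OF n st]
  let ?q = "\<lambda>k::real^'a. cosh r * sqrt (1 - (norm k)\<^sup>2)"
  have "lorentz (a, 1) (Rep_hyp y) < ?q a" "lorentz (b, 1) (Rep_hyp y) < ?q b"
    using ab by (auto simp: klein_dist_less_iff[OF _ assms])
  then have "s * lorentz (a, 1) (Rep_hyp y) + t * lorentz (b, 1) (Rep_hyp y) < s * ?q a + t * ?q b"
    using st
    by (cases "s = 0") (auto intro!: add_less_le_mono mult_strict_left_mono mult_left_mono)
  also have "\<dots> \<le> ?q (s *\<^sub>R a + t *\<^sub>R b)"
    using cc(3)[of "cosh r"] by (simp add: algebra_simps)
  finally show "s *\<^sub>R a + t *\<^sub>R b \<in> {k. norm k < 1 \<and> dist (klein k) y < r}"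
    using cc(1) by (simp add: klein_dist_less_iff[OF _ assms] cc(2))
qed

lemma convex_klein_cball:
  assumes "0 \<le> r"
  shows "convex {k. norm k < 1 \<and> dist (klein k) y \<le> r}"
proof -
  have "{k. norm k < 1 \<and> dist (klein k) y \<le> r} = (\<Inter>r'\<in>{r<..}. {k. norm k < 1 \<and> dist (klein k) y < r'})"
  proof (intro equalityI subsetI)
    fix k assume k: "k \<in> (\<Inter>r'\<in>{r<..}. {k. norm k < 1 \<and> dist (klein k) y < r'})"
    then have "norm k < 1" using gt_ex[of r] by auto
    moreover have "dist (klein k) y \<le> r" by (rule dense_ge) (use k in \<open>auto simp: less_imp_le\<close>)
    ultimately show "k \<in> {k. norm k < 1 \<and> dist (klein k) y \<le> r}" by simp
  qed auto
  then show ?thesis using assms by (auto intro!: convex_INT convex_klein_ball)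
qed

text \<open>Both sets are convex in Klein coordinates. These intersections are the connected pieces
  used at the boundary of the closed ball and in the countable cover.\<close>

lemma connected_ball_Int_cball_hyp:
  fixes x y :: "'d::finite hyp"
  assumes "0 \<le> r" "0 \<le> s"
  shows "connected (ball x r \<inter> cball y s)"
proof -
  let ?K = "{k. norm k < 1 \<and> dist (klein k) x < r} \<inter> {k. norm k < 1 \<and> dist (klein k) y \<le> s}"
  have "connected (klein ` ?K)"
  proof (rule connected_continuous_image)
    show "continuous_on ?K klein" by (rule continuous_on_subset[OF continuous_on_klein]) auto
    show "connected ?K" using assms by (intro convex_connected convex_Int convex_klein_ball convex_klein_cball)
  qed
  moreover have "klein ` ?K = ball x r \<inter> cball y s"
  proof (intro equalityI subsetI)
    fix z assume z: "z \<in> ball x r \<inter> cball y s"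
    obtain k where "norm k < 1" "z = klein k" by (rule klein_surj)
    then show "z \<in> klein ` ?K" using z by (auto simp: dist_commute)
  qed (auto simp: dist_commute)
  ultimately show ?thesis by simp
qed

lemma countable_dense_hyp:
  obtains d :: "nat \<Rightarrow> 'd::finite hyp" where "\<And>x e. 0 < e \<Longrightarrow> \<exists>n. dist (d n) x < e"
proof -
  obtain D :: "(real^'d) set" where D: "countable D"
    "\<And>X. open X \<Longrightarrow> X \<noteq> {} \<Longrightarrow> \<exists>k\<in>D. k \<in> X"
    using countable_dense_setE by metis
  have "D \<noteq> {}" using D(2)[of UNIV] by auto
  \<comment> \<open>Members of \<open>D\<close> outside the unit ball go to unspecified points,
    which does not affect density.\<close>
  have "\<exists>n. dist (klein (from_nat_into D n)) x < e" if "0 < e" for x :: "'d hyp" and e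
  proof -
    obtain k where k: "norm k < 1" "x = klein k" by (rule klein_surj)
    have "open (ball 0 1 \<inter> klein -` ball x e)"
      by (rule continuous_open_preimage[OF continuous_on_klein]) auto
    moreover have "k \<in> ball 0 1 \<inter> klein -` ball x e" using k that by simp
    ultimately obtain k' where "k' \<in> D" "k' \<in> ball 0 1 \<inter> klein -` ball x e" using D(2) by blast
    then show ?thesis
      using from_nat_into_surj[OF D(1), of k'] by (auto simp: dist_commute)
  qed
  then show thesis by (rule that)
qed

text \<open>Shrinking a nonzero \<open>k\<close> radially strictly raises
  \<open>sqrt (1 - (norm k)\<^sup>2)\<close>, so a boundary point is approached from strictly inside
  the ball.\<close>

lemma cball_subset_closure_ball_hyp:
  fixes x :: "'d::finite hyp"
  assumes r: "0 < r" and x: "x \<in> cball origin r"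
  shows "x \<in> closure (ball origin r)"
proof -
  obtain k where k: "norm k < 1" "x = klein k" by (rule klein_surj)
  have "((\<lambda>s. klein (s *\<^sub>R k)) \<longlongrightarrow> klein (1 *\<^sub>R k)) (at_left (1::real))"
  proof -
    have "continuous_on (ball 0 1) (klein :: real^'d \<Rightarrow> 'd hyp)" by (rule continuous_on_klein)
    then have "isCont klein k" using k(1) by (simp add: continuous_on_eq_continuous_at)
    moreover have "((\<lambda>s::real. s *\<^sub>R k) \<longlongrightarrow> k) (at_left 1)"
      by (auto intro!: tendsto_eq_intros)
    ultimately show ?thesis by (simp add: isCont_tendsto_compose[of k klein])
  qed
  moreover have "\<forall>\<^sub>F s in at_left (1::real). klein (s *\<^sub>R k) \<in> closure (ball origin r)"
  proof -
    have "\<forall>\<^sub>F s in at_left (1::real). s \<in> {0<..<1}" by (rule eventually_at_left_real) simp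
    then show ?thesis
    proof eventually_elim
      case (elim s)
      have "dist (klein k) origin \<le> r" using x k by (simp add: dist_commute not_le)
      then have le: "1 \<le> cosh r * sqrt (1 - (norm k)\<^sup>2)"
        using klein_dist_greater_iff[OF k(1), of r origin] r
        by (simp add: lorentz_def Rep_hyp_origin not_less[symmetric])
      have n: "norm (s *\<^sub>R k) < 1" "norm (s *\<^sub>R k) \<le> norm k"
        using elim k(1) mult_left_le_one_le[of "norm k" s] by auto
      have "1 < cosh r * sqrt (1 - (norm (s *\<^sub>R k))\<^sup>2)"
      proof (cases "k = 0")
        case True
        then show ?thesis using r cosh_real_strict_mono[of 0 r] by simp
      next
        case False
        then have "norm (s *\<^sub>R k) < norm k" using elim by simp
        then have "(norm (s *\<^sub>R k))\<^sup>2 < (norm k)\<^sup>2" by (intro power_strict_mono) auto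
        then have "cosh r * sqrt (1 - (norm k)\<^sup>2) < cosh r * sqrt (1 - (norm (s *\<^sub>R k))\<^sup>2)"
          by (simp add: cosh_real_pos)
        with le show ?thesis by linarith
      qed
      then have "klein (s *\<^sub>R k) \<in> ball origin r"
        using klein_dist_less_iff[OF n(1), of r origin] r
        by (simp add: lorentz_def Rep_hyp_origin dist_commute)
      then show ?case using closure_subset by blast
    qed
  qed
  ultimately have "klein (1 *\<^sub>R k) \<in> closure (ball origin r)"
    by (intro Lim_in_closed_set[of _ "\<lambda>s. klein (s *\<^sub>R k)" "at_left 1"]) auto
  then show ?thesis using k by simp
qed

section \<open>The component bound for the vacant set\<close>

lemma comps_le_vacant_open_ball:
  fixes Y :: "'d::finite hyp set"
  assumes "finite Y" "0 < r" "0 < R"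
  shows "comps_le {x \<in> ball origin R. \<forall>y\<in>Y. r < dist x y} (2 * (card Y + 2) ^ CARD('d))"
proof -
  \<comment> \<open>At \<open>(k, t)\<close> the half-space of \<open>hs y\<close> reads
    \<open>lorentz (k, 1) (Rep_hyp y) > cosh r * t\<close>.\<close>
  define hs :: "'d hyp \<Rightarrow> ((real^'d) \<times> real) \<times> real" where
    "hs y = ((- fst (Rep_hyp y), - cosh r), - snd (Rep_hyp y))" for y
  \<comment> \<open>The inserted half-space \<open>t > 1 / cosh R\<close> is the ball around the
    origin; its positive level also excludes the lower hemisphere.\<close>
  define F where "F = insert ((0, 1), 1 / cosh R) (hs ` Y)"
  define T where "T = UNIV \<inter> sphere 0 1 \<inter> (\<Inter>(u, c)\<in>F. {x. u \<bullet> x > c})"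
  have fin: "finite F" using assms by (simp add: F_def)
  have T: "(k, t) \<in> T \<longleftrightarrow> norm k < 1 \<and> t = sqrt (1 - (norm k)\<^sup>2) \<and> dist (klein k) origin < R
      \<and> (\<forall>y\<in>Y. r < dist (klein k) y)" for k t
  proof (cases "norm k < 1 \<and> t = sqrt (1 - (norm k)\<^sup>2)")
    case True
    then have k: "norm k < 1" and t: "t = sqrt (1 - (norm k)\<^sup>2)" by auto
    have "norm (k, t) = 1" using k by (simp add: t norm_Pair abs_square_less_1 less_imp_le)
    then have "(k, t) \<in> T \<longleftrightarrow> 1 / cosh R < t \<and> (\<forall>y\<in>Y. - snd (Rep_hyp y) < - (fst (Rep_hyp y) \<bullet> k) - cosh r * t)"
      by (auto simp: T_def F_def hs_def)
    also have "1 / cosh R < t \<longleftrightarrow> dist (klein k) origin < R"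
      using assms(3) klein_dist_less_iff[OF k, of R origin]
      by (simp add: lorentz_def Rep_hyp_origin t pos_divide_less_eq cosh_real_pos mult.commute)
    also have "(\<forall>y\<in>Y. - snd (Rep_hyp y) < - (fst (Rep_hyp y) \<bullet> k) - cosh r * t) \<longleftrightarrow> (\<forall>y\<in>Y. r < dist (klein k) y)"
    proof (rule ball_cong[OF refl])
      fix y
      show "- snd (Rep_hyp y) < - (fst (Rep_hyp y) \<bullet> k) - cosh r * t \<longleftrightarrow> r < dist (klein k) y"
        using assms(2) klein_dist_greater_iff[OF k, of r y]
        by (simp add: lorentz_def inner_commute flip: t) linarith
    qed
    finally show ?thesis using True by simp
  next
    case False
    have "\<not> (norm (k, t) = 1 \<and> 1 / cosh R < t)"
    proof
      assume *: "norm (k, t) = 1 \<and> 1 / cosh R < t"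
      have "0 < 1 / cosh R" by (simp add: cosh_real_pos)
      then have "0 < t" using * by linarith
      have "(norm k)\<^sup>2 + t\<^sup>2 = 1" using * by (simp add: norm_Pair)
      then have "t = sqrt (1 - (norm k)\<^sup>2)" "(norm k)\<^sup>2 < 1"
        using \<open>0 < t\<close> by (auto simp: real_sqrt_unique algebra_simps) (smt (verit) zero_less_power)
      then show False using False by (simp add: abs_square_less_1)
    qed
    then show ?thesis using False by (auto simp: T_def F_def)
  qed
  have "comps_le T (2 * (card F + 1) ^ CARD('d))"
    unfolding T_def by (rule comps_le_sphere_Int_halfspaces[OF fin]) (auto simp: aff_dim_UNIV)
  \<comment> \<open>One half-space for each point of \<open>Y\<close> and one for the ball; the
    sphere bound adds the other 1 in \<open>card Y + 2\<close>.\<close>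
  moreover have "card F \<le> card Y + 1"
    unfolding F_def using card_image_le[OF assms(1), of hs] assms(1) by (simp add: card_insert_if)
  then have "2 * (card F + 1) ^ CARD('d) \<le> 2 * (card Y + 2) ^ CARD('d)"
    by (intro mult_le_mono2 power_mono) auto
  ultimately have le: "comps_le T (2 * (card Y + 2) ^ CARD('d))" by (rule comps_le_mono)
  show ?thesis
  proof (rule comps_le_image[where f = "\<lambda>z. klein (fst z)", OF _ _ _ le])
    show "continuous_on T (\<lambda>z. klein (fst z))"
      by (rule continuous_on_compose2[OF continuous_on_klein continuous_on_fst[OF continuous_on_id]])
        (auto simp: T)
    show "(\<lambda>z. klein (fst z)) ` T \<subseteq> {x \<in> ball origin R. \<forall>y\<in>Y. r < dist x y}"
      by (auto simp: T dist_commute)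
    fix x assume x: "x \<in> {x \<in> ball origin R. \<forall>y\<in>Y. r < dist x y}"
    obtain k where k: "norm k < 1" "x = klein k" by (rule klein_surj)
    then have "(k, sqrt (1 - (norm k)\<^sup>2)) \<in> T" using x by (auto simp: T dist_commute)
    then show "\<exists>z\<in>T. connected_component {x \<in> ball origin R. \<forall>y\<in>Y. r < dist x y} x (klein (fst z))"
      using x k by (intro bexI[of _ "(k, sqrt (1 - (norm k)\<^sup>2))"]) auto
  qed
qed

text \<open>No component lies entirely on the boundary sphere: a small ball around a vacant point
  avoids the obstacles, its intersection with the closed ball is connected, and it meets the open
  ball.\<close>

lemma comps_le_vacant_cball:
  fixes Y :: "'d::finite hyp set"
  assumes Y: "finite Y" and r: "0 < r" "0 < R"
  shows "comps_le {x \<in> cball origin R. \<forall>y\<in>Y. r < dist x y} (2 * (card Y + 2) ^ CARD('d))"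
proof (rule comps_le_image[where f = "\<lambda>x. x", OF _ _ _ comps_le_vacant_open_ball[OF assms]])
  let ?V = "{x \<in> cball origin R. \<forall>y\<in>Y. r < dist x y}"
  let ?U = "{x \<in> ball origin R. \<forall>y\<in>Y. r < dist x y}"
  fix x assume x: "x \<in> ?V"
  have "open (\<Inter>y\<in>Y. - cball y r)" using Y by (intro open_INT) auto
  moreover have "x \<in> (\<Inter>y\<in>Y. - cball y r)" using x by (auto simp: dist_commute)
  ultimately obtain e where e: "0 < e" "ball x e \<subseteq> (\<Inter>y\<in>Y. - cball y r)" by (meson openE)
  have "ball x e \<inter> ball origin R \<noteq> {}"
  proof -
    have "x \<in> ball x e \<inter> closure (ball origin R)"
      using cball_subset_closure_ball_hyp[OF r(2), of x] x e(1) by simp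
    then show ?thesis using open_Int_closure_eq_empty[OF open_ball, of x e "ball origin R"] by blast
  qed
  then obtain z where z: "z \<in> ball x e" "z \<in> ball origin R" by blast
  have "\<forall>y\<in>Y. z \<in> - cball y r" using z(1) e(2) by blast
  then have "z \<in> ?U" using z(2) by (simp add: dist_commute not_le)
  moreover have "connected_component ?V x z"
    unfolding connected_component_def
  proof (intro exI conjI)
    show "connected (ball x e \<inter> cball origin R)"
      using e(1) r by (intro connected_ball_Int_cball_hyp) auto
    show "ball x e \<inter> cball origin R \<subseteq> ?V"
    proof
      fix w assume w: "w \<in> ball x e \<inter> cball origin R"
      then have "\<forall>y\<in>Y. w \<in> - cball y r" using e(2) by blast
      then show "w \<in> ?V" using w by (simp add: dist_commute not_le)
    qed
  qed (use x z e(1) in auto)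
  ultimately show "\<exists>z\<in>?U. connected_component ?V x z" by (rule bexI[rotated])
next
  show "continuous_on {x \<in> ball origin R. \<forall>y\<in>Y. r < dist x y} (\<lambda>x. x)"
    by (rule continuous_on_id)
qed auto

section \<open>Measurability\<close>

text \<open>Connectedness of the \<open>A j\<close> keeps a chain of overlapping members inside one
  component, and their openness makes the chain class locally constant along a component.
  Representing each class by its least index turns the components into a set of natural numbers,
  whose size is a countable sum of indicators.\<close>

lemma num_components_countable_cover:
  fixes A :: "nat \<Rightarrow> 'a::topological_space set" and G :: "nat set"
  assumes S: "S = (\<Union>j\<in>G. A j)"
    and A: "\<And>j. j \<in> G \<Longrightarrow> openin (top_of_set S) (A j)" "\<And>j. j \<in> G \<Longrightarrow> connected (A j)"
      "\<And>j. j \<in> G \<Longrightarrow> A j \<noteq> {}"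
  defines "E \<equiv> {(i, j). i \<in> G \<and> j \<in> G \<and> A i \<inter> A j \<noteq> {}}"
  shows "num_components S = emeasure (count_space UNIV) {j \<in> G. \<forall>i<j. (i, j) \<notin> E\<^sup>*}"
proof -
  have sym: "(j, i) \<in> E\<^sup>*" if "(i, j) \<in> E\<^sup>*" for i j
  proof -
    have "sym E" by (auto simp: E_def sym_def)
    then show ?thesis using that sym_rtrancl symD by metis
  qed
  have in_G: "i \<in> G" if "(i, j) \<in> E\<^sup>*" "j \<in> G" for i j
    using that by (induction rule: converse_rtrancl_induct) (auto simp: E_def)
  have chain: "connected_component S x y" if ij: "(i, j) \<in> E\<^sup>*" and i: "i \<in> G" and xy: "x \<in> A i" "y \<in> A j"
    for i j x y
    using ij xy(2)
  proof (induction arbitrary: y rule: rtrancl_induct)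
    case base
    then show ?case using A(2)[OF i] xy(1) S i unfolding connected_component_def by blast
  next
    case (step j k)
    then obtain z where z: "z \<in> A j" "z \<in> A k" "k \<in> G" by (auto simp: E_def)
    then have "connected_component S z y"
      using A(2)[OF z(3)] step.prems S unfolding connected_component_def by blast
    then show ?case using step.IH[OF z(1)] connected_component_trans by metis
  qed
  have unchain: "(i, j) \<in> E\<^sup>*"
    if c: "connected_component S x y" and ij: "i \<in> G" "j \<in> G" "x \<in> A i" "y \<in> A j" for i j x y
  proof -
    let ?R = "\<lambda>a b. \<forall>i\<in>G. \<forall>j\<in>G. a \<in> A i \<longrightarrow> b \<in> A j \<longrightarrow> (i, j) \<in> E\<^sup>*"
    define D where "D = connected_component_set S x"
    have DS: "D \<subseteq> S" unfolding D_def by (rule connected_component_subset)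
    have "connected D" "x \<in> D" "y \<in> D" using c ij S by (auto simp: D_def)
    then have "?R x y"
    proof (rule connected_equivalence_relation)
      fix a b c assume ab: "?R a b" and bc: "?R b c" and "b \<in> D"
      then obtain k where k: "k \<in> G" "b \<in> A k" using DS S by blast
      show "?R a c"
      proof (intro ballI impI)
        fix i j assume "i \<in> G" "j \<in> G" "a \<in> A i" "c \<in> A j"
        then have "(i, k) \<in> E\<^sup>*" "(k, j) \<in> E\<^sup>*" using ab bc k by blast+
        then show "(i, j) \<in> E\<^sup>*" by (rule rtrancl_trans)
      qed
    next
      fix a assume "a \<in> D"
      then obtain k where k: "k \<in> G" "a \<in> A k" using DS S by blast
      have "openin (top_of_set D) (D \<inter> A k)"
        using A(1)[OF k(1)] DS by (auto simp: openin_open)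
      moreover have "?R a b" if "b \<in> D \<inter> A k" for b
      proof (intro ballI impI)
        fix i j assume "i \<in> G" "j \<in> G" "a \<in> A i" "b \<in> A j"
        then have "(i, k) \<in> E" "(k, j) \<in> E" using k that by (auto simp: E_def)
        then show "(i, j) \<in> E\<^sup>*" by (meson converse_rtrancl_into_rtrancl r_into_rtrancl)
      qed
      ultimately show "\<exists>T. openin (top_of_set D) T \<and> a \<in> T \<and> (\<forall>b\<in>T. ?R a b)"
        using k \<open>a \<in> D\<close> by (intro exI[of _ "D \<inter> A k"]) blast
    qed (use sym in blast)
    then show ?thesis using ij by blast
  qed
  define M where "M = {j \<in> G. \<forall>i<j. (i, j) \<notin> E\<^sup>*}"
  define p where "p j = (SOME x. x \<in> A j)" for j
  have p: "p j \<in> A j" if "j \<in> G" for j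
    unfolding p_def using A(3)[OF that] by (simp add: some_in_eq)
  define f where "f j = connected_component_set S (p j)" for j
  have "bij_betw f M (components S)"
    unfolding bij_betw_def
  proof (intro conjI inj_onI equalityI subsetI)
    fix i j assume ij: "i \<in> M" "j \<in> M" "f i = f j"
    then have G: "i \<in> G" "j \<in> G" by (auto simp: M_def)
    have "p j \<in> S" using p[OF G(2)] G(2) S by blast
    then have "p j \<in> f j" by (simp add: f_def)
    then have "connected_component S (p i) (p j)" unfolding ij(3)[symmetric] by (simp add: f_def)
    then have "(i, j) \<in> E\<^sup>*" using unchain G p by blast
    moreover from this have "(j, i) \<in> E\<^sup>*" by (rule sym)
    ultimately show "i = j" using ij(1,2) by (cases i j rule: linorder_cases) (auto simp: M_def)
  next
    fix C assume "C \<in> f ` M"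
    then obtain j where j: "j \<in> G" "C = connected_component_set S (p j)" by (auto simp: M_def f_def)
    then have "p j \<in> S" using p S by blast
    then show "C \<in> components S" using j(2) by (auto simp: components_iff)
  next
    fix C assume "C \<in> components S"
    then obtain x where x: "x \<in> S" "C = connected_component_set S x" by (auto simp: components_iff)
    then obtain j where j: "j \<in> G" "x \<in> A j" using S by blast
    define i where "i = (LEAST i. (i, j) \<in> E\<^sup>*)"
    have ij: "(i, j) \<in> E\<^sup>*" unfolding i_def by (rule LeastI[of _ j]) simp
    then have iG: "i \<in> G" using in_G j(1) by blast
    have "i \<in> M"
      unfolding M_def
    proof (intro CollectI conjI allI impI iG notI)
      fix i' assume "i' < i" "(i', i) \<in> E\<^sup>*"
      then have "(i', j) \<in> E\<^sup>*" using ij by (meson rtrancl_trans)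
      then show False using not_less_Least \<open>i' < i\<close> unfolding i_def by blast
    qed
    moreover have "connected_component S (p i) x" using chain[OF ij iG p[OF iG] j(2)] .
    then have "C = f i" unfolding f_def x(2) by (intro connected_component_eq) simp
    ultimately show "C \<in> f ` M" by blast
  qed
  then have "finite M \<longleftrightarrow> finite (components S)" "card M = card (components S)"
    by (auto simp: bij_betw_finite bij_betw_same_card)
  then show ?thesis
    unfolding num_components_def M_def[symmetric] by (simp add: emeasure_count_space)
qed

text \<open>Reachability is a countable union over chain lengths and intermediate vertices.\<close>

lemma pred_rtrancl_nat:
  fixes E :: "'a \<Rightarrow> (nat \<times> nat) set"
  assumes E[measurable]: "\<And>i j. Measurable.pred M (\<lambda>\<omega>. (i, j) \<in> E \<omega>)"
  shows "Measurable.pred M (\<lambda>\<omega>. (i, j) \<in> (E \<omega>)\<^sup>*)"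
proof -
  have [measurable]: "Measurable.pred M (\<lambda>\<omega>. (i, j) \<in> E \<omega> ^^ n)" for n
  proof (induction n arbitrary: j)
    case (Suc n)
    note Suc.IH[measurable]
    have "(\<lambda>\<omega>. (i, j) \<in> E \<omega> ^^ Suc n) = (\<lambda>\<omega>. \<exists>k. (i, k) \<in> E \<omega> ^^ n \<and> (k, j) \<in> E \<omega>)"
      by (auto simp: relcomp_unfold)
    then show ?case by simp
  qed simp
  show ?thesis unfolding rtrancl_power by measurable
qed

section \<open>Configurations: local finiteness, the moment bound and measurability\<close>

lemma emeasure_counting_measure_cball:
  assumes "finite (S \<inter> cball x r)"
  shows "emeasure (counting_measure S) (cball x r) = of_nat (card (S \<inter> cball x r))"
  using assms by (simp add: emeasure_counting_measure(2) emeasure_count_space)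

lemma simple_counting_measuresE:
  assumes "\<omega> \<in> simple_counting_measures"
  obtains S where "\<omega> = counting_measure S" "\<And>x r. finite (S \<inter> cball x r)" "supp \<omega> = S"
proof -
  obtain S where S: "\<omega> = counting_measure S"
    and bd: "\<And>B. B \<in> sets borel \<Longrightarrow> bounded B \<Longrightarrow> emeasure \<omega> B < \<infinity>"
    using assms by (auto simp: simple_counting_measures_def)
  have fin: "finite (S \<inter> cball x r)" for x r
    using bd[of "cball x r"]
    by (auto simp: S emeasure_counting_measure(2) emeasure_count_space split: if_splits)
  have "supp \<omega> = S"
  proof (intro equalityI subsetI)
    fix x assume x: "x \<in> supp \<omega>"
    show "x \<in> S"
    proof (rule ccontr)
      assume "x \<notin> S"
      \<comment> \<open>Only finitely many atoms lie near \<open>x\<close>, so removing them leaves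
        an open neighbourhood.\<close>
      define U where "U = ball x 1 - (S \<inter> cball x 1)"
      have "open U" unfolding U_def by (intro open_Diff finite_imp_closed fin) simp
      moreover have "x \<in> U" using \<open>x \<notin> S\<close> by (simp add: U_def)
      moreover have "S \<inter> U = {}" by (auto simp: U_def)
      ultimately show False using x by (auto simp: supp_def S emeasure_counting_measure(2))
    qed
  next
    fix x assume x: "x \<in> S"
    have "emeasure \<omega> U > 0" if "open U" "x \<in> U" for U
      using that x by (auto simp: S emeasure_counting_measure(2) emeasure_count_space card_gt_0_iff)
    then show "x \<in> supp \<omega>" by (auto simp: supp_def)
  qed
  then show thesis using that S fin by blast
qed

text \<open>An atom farther than 2 from the origin is farther than 1 from every point of the closed
  unit ball. This is the origin of the radius 2.\<close>

lemma vacant_Int_cball: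
  fixes \<omega> :: "'d::finite hyp measure"
  assumes "supp \<omega> = S"
  shows "vacant \<omega> \<inter> cball origin 1 = {x \<in> cball origin 1. \<forall>y\<in>S \<inter> cball origin 2. 1 < dist x y}"
proof (intro equalityI subsetI)
  fix x assume x: "x \<in> {x \<in> cball origin 1. \<forall>y\<in>S \<inter> cball origin 2. 1 < dist x y}"
  have "1 < dist x y" if "y \<in> S" for y
  proof (cases "y \<in> cball origin 2")
    case False
    then show ?thesis using x dist_triangle[of origin y x] by auto
  qed (use x that in blast)
  then show "x \<in> vacant \<omega> \<inter> cball origin 1"
    using x by (force simp: vacant_def occupied_def assms dist_commute)
qed (auto simp: vacant_def occupied_def assms dist_commute not_le)

lemma num_components_vacant_le:
  fixes \<omega> :: "'d::finite hyp measure"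
  assumes "\<omega> \<in> simple_counting_measures"
  shows "num_components (vacant \<omega> \<inter> cball origin 1)
    \<le> of_nat (2 * 3 ^ CARD('d)) * (1 + emeasure \<omega> (cball origin 2) ^ CARD('d))"
proof -
  obtain S where S: "\<omega> = counting_measure S" "\<And>x r. finite (S \<inter> cball x r)" "supp \<omega> = S"
    using simple_counting_measuresE[OF assms] by blast
  let ?n = "card (S \<inter> cball origin 2)" and ?d = "CARD('d)"
  have "num_components (vacant \<omega> \<inter> cball origin 1) \<le> of_nat (2 * (?n + 2) ^ ?d)"
    unfolding vacant_Int_cball[OF S(3)]
    by (intro num_components_le comps_le_vacant_cball S(2)) auto
  \<comment> \<open>\<open>n + 2\<close> is at most three times the maximum of 1 and
    \<open>n\<close>; the summand 1 covers \<open>n = 0\<close>.\<close>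
  also have "2 * (?n + 2) ^ ?d \<le> 2 * 3 ^ ?d * (1 + ?n ^ ?d)"
  proof -
    have "(?n + 2) ^ ?d \<le> (3 * max 1 ?n) ^ ?d" by (intro power_mono) auto
    also have "\<dots> = 3 ^ ?d * max 1 ?n ^ ?d" by (rule power_mult_distrib)
    also have "max 1 ?n ^ ?d \<le> 1 + ?n ^ ?d" by (auto simp: max_def)
    finally show ?thesis by simp
  qed
  finally show ?thesis
    by (simp add: S(1) emeasure_counting_measure_cball[OF S(2)] distrib_left)
qed

lemma
  assumes P: "sets P = sets (configurations :: 'd::finite hyp measure measure)"
  shows space_configurations: "space P = simple_counting_measures"
    and measurable_emeasure_configurations:
      "B \<in> sets borel \<Longrightarrow> (\<lambda>\<omega>. emeasure \<omega> B) \<in> borel_measurable P"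
proof -
  have gens: "{{\<omega> \<in> simple_counting_measures. emeasure \<omega> B \<in> A} | B A. B \<in> sets borel \<and> A \<in> sets borel}
      \<subseteq> Pow (simple_counting_measures :: 'd hyp measure set)"
    by blast
  show space: "space P = simple_counting_measures"
    using sets_eq_imp_space_eq[OF P] by (simp add: configurations_def space_measure_of[OF gens])
  show "(\<lambda>\<omega>. emeasure \<omega> B) \<in> borel_measurable P" if B: "B \<in> sets borel"
  proof (rule measurableI)
    fix A :: "ennreal set" assume "A \<in> sets borel"
    then have "{\<omega> \<in> simple_counting_measures. emeasure \<omega> B \<in> A} \<in> sets P"
      unfolding P configurations_def sets_measure_of[OF gens]
      using B by (intro sigma_sets.Basic) blast
    moreover have "(\<lambda>\<omega>. emeasure \<omega> B) -` A \<inter> space P = {\<omega> \<in> simple_counting_measures. emeasure \<omega> B \<in> A}"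
      by (auto simp: space)
    ultimately show "(\<lambda>\<omega>. emeasure \<omega> B) -` A \<inter> space P \<in> sets P" by simp
  qed simp
qed

lemma measurable_num_components_vacant:
  assumes P: "sets P = sets (configurations :: 'd::finite hyp measure measure)"
  shows "(\<lambda>\<omega>. num_components (vacant \<omega> \<inter> cball origin 1)) \<in> borel_measurable P"
proof -
  obtain d :: "nat \<Rightarrow> 'd hyp" where d: "\<And>x e. 0 < e \<Longrightarrow> \<exists>n. dist (d n) x < e"
    by (rule countable_dense_hyp) blast
  define z where "z j = d (fst (prod_decode j))" for j
  define r :: "nat \<Rightarrow> real" where "r j = inverse (of_nat (Suc (snd (prod_decode j))))" for j
  have r: "0 < r j" for j by (simp add: r_def)
  define A where "A j = ball (z j) (r j) \<inter> cball origin 1" for j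
  \<comment> \<open>The pieces \<open>A j\<close> do not depend on the configuration; only the index
    set does, through one evaluation of \<open>\<omega>\<close> per index. An empty ball of radius
    \<open>1 + r j\<close> keeps every point of \<open>A j\<close> at distance more than 1 from all
    atoms.\<close>
  define G where "G \<omega> = {j. A j \<noteq> {} \<and> emeasure \<omega> (cball (z j) (1 + r j)) = 0}" for \<omega>
  define E where "E \<omega> = {(i, j). i \<in> G \<omega> \<and> j \<in> G \<omega> \<and> A i \<inter> A j \<noteq> {}}" for \<omega>
  have space: "space P = simple_counting_measures" by (rule space_configurations[OF P])
  have [measurable]: "Measurable.pred P (\<lambda>\<omega>. j \<in> G \<omega>)" for j
  proof -
    have [measurable]: "(\<lambda>\<omega>. emeasure \<omega> (cball (z j) (1 + r j))) \<in> borel_measurable P"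
      by (rule measurable_emeasure_configurations[OF P]) simp
    show ?thesis unfolding G_def by measurable
  qed
  have [measurable]: "Measurable.pred P (\<lambda>\<omega>. (i, j) \<in> (E \<omega>)\<^sup>*)" for i j
    by (rule pred_rtrancl_nat) (simp add: E_def)
  have eq: "num_components (vacant \<omega> \<inter> cball origin 1)
      = (\<Sum>j. indicator {j \<in> G \<omega>. \<forall>i<j. (i, j) \<notin> (E \<omega>)\<^sup>*} j)" if \<omega>: "\<omega> \<in> space P" for \<omega>
  proof -
    obtain S where S: "\<omega> = counting_measure S" "\<And>x r. finite (S \<inter> cball x r)" "supp \<omega> = S"
      using simple_counting_measuresE[of \<omega>] \<omega> space by blast
    have good: "emeasure \<omega> (cball x s) = 0 \<longleftrightarrow> (\<forall>y\<in>S. s < dist x y)" for x s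
      unfolding S(1) emeasure_counting_measure_cball[OF S(2)]
      using S(2)[of x s] by (auto simp: not_le)
    let ?V = "vacant \<omega> \<inter> cball origin 1"
    have V: "x \<in> ?V \<longleftrightarrow> x \<in> cball origin 1 \<and> (\<forall>y\<in>S. 1 < dist x y)" for x
      by (force simp: vacant_def occupied_def S(3) dist_commute not_le)
    have sub: "A j \<subseteq> ?V" if "j \<in> G \<omega>" for j
    proof
      fix x assume x: "x \<in> A j"
      have "1 < dist x y" if "y \<in> S" for y
      proof -
        have "1 + r j < dist (z j) y" using \<open>j \<in> G \<omega>\<close> that by (auto simp: G_def good)
        moreover have "dist (z j) x < r j" using x by (simp add: A_def)
        ultimately show ?thesis using dist_triangle[of "z j" y x] by linarith
      qed
      then show "x \<in> ?V" using x V by (auto simp: A_def)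
    qed
    have "?V = (\<Union>j\<in>G \<omega>. A j)"
    proof (intro equalityI subsetI)
      fix x assume x: "x \<in> ?V"
      \<comment> \<open>\<open>Min D\<close> is the distance to the nearest atom, capped at 2; it
        exceeds 1 because the minimum is over a finite set. Half the margin goes to the radius and
        half to the offset of the centre.\<close>
      define D where "D = insert 2 ((\<lambda>y. dist x y) ` (S \<inter> cball x 2))"
      have "finite D" unfolding D_def using S(2) by blast
      have "1 < Min D" using x V \<open>finite D\<close> by (auto simp: D_def)
      have minD: "Min D \<le> dist x y" if "y \<in> S" for y
      proof (cases "y \<in> cball x 2")
        case True
        then show ?thesis using \<open>finite D\<close> that by (intro Min_le) (auto simp: D_def)
      next
        case False
        have "Min D \<le> 2" using \<open>finite D\<close> by (intro Min_le) (auto simp: D_def)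
        then show ?thesis using False by simp
      qed
      obtain m where m: "inverse (of_nat (Suc m)) < (Min D - 1) / 2"
        using reals_Archimedean[of "(Min D - 1) / 2"] \<open>1 < Min D\<close> by auto
      obtain n where n: "dist (d n) x < inverse (of_nat (Suc m))"
        using d[of "inverse (of_nat (Suc m))" x] by auto
      define j where "j = prod_encode (n, m)"
      have zr: "z j = d n" "r j = inverse (of_nat (Suc m))" by (simp_all add: z_def r_def j_def)
      have xA: "x \<in> A j" using n x by (simp add: A_def zr)
      have "1 + r j < dist (z j) y" if "y \<in> S" for y
        using minD[OF that] m n dist_triangle[of x y "z j"] zr by (simp add: dist_commute)
      then have "j \<in> G \<omega>" using xA by (auto simp: G_def good)
      then show "x \<in> (\<Union>j\<in>G \<omega>. A j)" using xA by blast
    qed (use sub in blast)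
    moreover have "openin (top_of_set ?V) (A j)" if "j \<in> G \<omega>" for j
    proof -
      have "A j = ?V \<inter> ball (z j) (r j)" using sub[OF that] by (auto simp: A_def)
      then show ?thesis by auto
    qed
    moreover have "connected (A j)" for j
      unfolding A_def using r[of j] by (intro connected_ball_Int_cball_hyp) auto
    moreover have "A j \<noteq> {}" if "j \<in> G \<omega>" for j
      using that by (simp add: G_def)
    ultimately have "num_components ?V
        = emeasure (count_space UNIV) {j \<in> G \<omega>. \<forall>i<j. (i, j) \<notin> (E \<omega>)\<^sup>*}"
      unfolding E_def by (rule num_components_countable_cover)
    also have "\<dots> = (\<integral>\<^sup>+j. indicator {j \<in> G \<omega>. \<forall>i<j. (i, j) \<notin> (E \<omega>)\<^sup>*} j \<partial>count_space UNIV)"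
      by simp
    finally show ?thesis by (simp only: nn_integral_count_space_nat)
  qed
  have "(\<lambda>\<omega>. \<Sum>j. indicator {j \<in> G \<omega>. \<forall>i<j. (i, j) \<notin> (E \<omega>)\<^sup>*} j :: ennreal) \<in> borel_measurable P"
    by measurable
  then show ?thesis by (simp cong: measurable_cong add: eq)
qed

theorem proposition1p2:
  fixes P :: "'d::finite hyp measure measure"
  assumes "prob_space P"
    and "sets P = sets configurations"
    and "(\<integral>\<^sup>+\<omega>. emeasure \<omega> (cball origin 2) ^ CARD('d) \<partial>P) < \<infinity>"
  shows "(\<lambda>\<omega>. num_components (vacant \<omega> \<inter> cball origin 1)) \<in> borel_measurable P \<and>
         (\<integral>\<^sup>+\<omega>. num_components (vacant \<omega> \<inter> cball origin 1) \<partial>P) < \<infinity>"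
proof
  show "(\<lambda>\<omega>. num_components (vacant \<omega> \<inter> cball origin 1)) \<in> borel_measurable P"
    by (rule measurable_num_components_vacant[OF assms(2)])
  interpret prob_space P by fact
  let ?c = "of_nat (2 * 3 ^ CARD('d)) :: ennreal" and ?f = "\<lambda>\<omega>. emeasure \<omega> (cball origin 2) ^ CARD('d)"
  have [measurable]: "(\<lambda>\<omega>. emeasure \<omega> (cball origin 2)) \<in> borel_measurable P"
    by (rule measurable_emeasure_configurations[OF assms(2)]) simp
  have "(\<integral>\<^sup>+\<omega>. num_components (vacant \<omega> \<inter> cball origin 1) \<partial>P) \<le> (\<integral>\<^sup>+\<omega>. ?c * (1 + ?f \<omega>) \<partial>P)"
    using num_components_vacant_le by (intro nn_integral_mono) (simp add: space_configurations[OF assms(2)])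
  also have "\<dots> = ?c * (1 + (\<integral>\<^sup>+\<omega>. ?f \<omega> \<partial>P))"
    by (simp add: nn_integral_cmult nn_integral_add emeasure_space_1)
  also have "\<dots> < \<infinity>"
    using assms(3) by (simp add: ennreal_mult_less_top power_less_top_ennreal)
  finally show "(\<integral>\<^sup>+\<omega>. num_components (vacant \<omega> \<inter> cball origin 1) \<partial>P) < \<infinity>" .
qed

end
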